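(* Let $f\in\mathbb{R}[x_1,\dots,x_n]$ be nonconstant and let $g\in\mathbb{R}[x_1,\dots,x_n,y_1,\dots,y_n]$ be $g(x_1,\dots,x_n,y_1,\dots,y_n)=\langle\nabla f(x_1,\dots,x_n),\nabla f(y_1,\dots,y_n)\rangle$. Let $I\subseteq\mathbb{R}^n$ be an axis-aligned $n$-dimensional cube. The number of (terminal) regions after the subdivision performed by the modified Plantinga–Vegter (PV) algorithm (before balancing) on input $(f,I)$ is bounded above by the maximum of $1$ and $$2^n\int_I\min\left\{\left(\frac{2^n\deg(f)+\sqrt{n}\ln\left(1+2^{2-2n}\right)}{2\ln\left(1+2^{2-2n}\right)\operatorname{dist}_{\mathbb{C}}(x,f)}\right)^n,\ \left(\frac{2^{2n+1}(\deg(f)-1)+\sqrt{2n}\ln\left(1+2^{2-4n}\right)}{2\ln\left(1+2^{2-4n}\right)\operatorname{dist}_{\mathbb{C}}((x,x),g)}\right)^n\right\}dV_n,$$ where $dV_n$ is the $n$-dimensional volume form. Moreover, the algorithm does not terminate if and only if the integral diverges.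
   Context: For a real polynomial $F$ in $N$ variables and $p\in\mathbb{R}^N$, $\operatorname{dist}_{\mathbb{C}}(p,F)$ is the Euclidean distance in $\mathbb{C}^N$ from $p$ to $V_{\mathbb{C}}(F)=\{z\in\mathbb{C}^N:F(z)=0\}$, taken to be $+\infty$ if $V_{\mathbb{C}}(F)=\emptyset$ (then the corresponding fraction is $0$); a fraction with denominator $0$ is $+\infty$. Standard centered form: for a polynomial $F\in\mathbb{R}[z_1,\dots,z_N]$ of total degree $D$ and an axis-aligned $N$-dimensional cube $Q$ (product of $N$ closed intervals of common width $w>0$) with midpoint $m$, $$\square F(Q)=F(m)+\left(\sum_{1\le|\alpha|\le D}\frac{|\partial^\alpha F(m)|}{\alpha!}\left(\frac{w}{2}\right)^{|\alpha|}\right)[-1,1].$$ Tests: for an axis-aligned cube $J\subseteq\mathbb{R}^n$: $C_0(J)$ is True iff $0\notin\square f(J)$; $C_1(J)$ is True iff $0\notin\square g(J\times J)$. Modified PV algorithm (main subdivision): start with $P=\{I\}$; as long as some $J\in P$ satisfies neither $C_0(J)$ nor $C_1(J)$, replace $J$ in $P$ by the $2^n$ congruent subcubes obtained by bisecting each side of $J$. The terminal regions are the elements of the final $P$ ("before balancing" means that no post-processing is applied). *)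

theory Defs
  imports "HOL-Analysis.Analysis" "HOL-Library.Poly_Mapping"
begin

text \<open>
  A polynomial with variables indexed by a finite type maps exponent vectors to coefficients;
  the ring operations are those of the convolution product on finitely supported maps.
\<close>

type_synonym 'v rpoly = "('v \<Rightarrow>\<^sub>0 nat) \<Rightarrow>\<^sub>0 real"

definition mdeg :: "('v::finite \<Rightarrow>\<^sub>0 nat) \<Rightarrow> nat" where
  "mdeg \<alpha> = (\<Sum>i\<in>UNIV. Poly_Mapping.lookup \<alpha> i)"

definition mfact :: "('v::finite \<Rightarrow>\<^sub>0 nat) \<Rightarrow> nat" where
  "mfact \<alpha> = (\<Prod>i\<in>UNIV. fact (Poly_Mapping.lookup \<alpha> i))"

text \<open>The zero polynomial gets degree 0.\<close>

definition pdeg :: "'v::finite rpoly \<Rightarrow> nat" where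
  "pdeg F = Max (insert 0 (mdeg ` Poly_Mapping.keys F))"

definition peval :: "'v::finite rpoly \<Rightarrow> 'a::real_field ^ 'v \<Rightarrow> 'a" where
  "peval F z = (\<Sum>\<mu>\<in>Poly_Mapping.keys F.
     of_real (Poly_Mapping.lookup F \<mu>) * (\<Prod>i\<in>UNIV. (z $ i) ^ Poly_Mapping.lookup \<mu> i))"

definition is_constant :: "'v rpoly \<Rightarrow> bool" where
  "is_constant F \<longleftrightarrow> (\<exists>c. F = Poly_Mapping.single 0 c)"

text \<open>
  The derivative of order \<open>\<alpha>\<close> sends the monomial with exponent \<open>\<mu>\<close> to the product over all \<open>i\<close> of
  \<open>\<mu>\<^sub>i (\<mu>\<^sub>i - 1) \<dots> (\<mu>\<^sub>i - \<alpha>\<^sub>i + 1)\<close>, which is \<open>\<alpha>\<^sub>i! (\<mu>\<^sub>i choose \<alpha>\<^sub>i)\<close>, times the monomial with exponent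
  \<open>\<mu> - \<alpha>\<close>. If \<open>\<alpha>\<^sub>i > \<mu>\<^sub>i\<close> for some \<open>i\<close>, the binomial coefficient vanishes, so the truncated
  subtraction is harmless.
\<close>

definition pdiff :: "('v::finite \<Rightarrow>\<^sub>0 nat) \<Rightarrow> 'v rpoly \<Rightarrow> 'v rpoly" where
  "pdiff \<alpha> F = (\<Sum>\<mu>\<in>Poly_Mapping.keys F.
     Poly_Mapping.single (\<mu> - \<alpha>)
       (real (\<Prod>i\<in>UNIV. fact (Poly_Mapping.lookup \<alpha> i) *
                 (Poly_Mapping.lookup \<mu> i choose Poly_Mapping.lookup \<alpha> i))
        * Poly_Mapping.lookup F \<mu>))"

abbreviation partial :: "'v::finite \<Rightarrow> 'v rpoly \<Rightarrow> 'v rpoly" where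
  "partial i \<equiv> pdiff (Poly_Mapping.single i 1)"

text \<open>Substitution of the variable \<open>h i\<close> for the variable \<open>i\<close>.\<close>

definition rename :: "('v \<Rightarrow> 'w) \<Rightarrow> 'v::finite rpoly \<Rightarrow> 'w rpoly" where
  "rename h F = (\<Sum>\<mu>\<in>Poly_Mapping.keys F.
     Poly_Mapping.single
       (\<Sum>i\<in>UNIV. Poly_Mapping.single (h i) (Poly_Mapping.lookup \<mu> i))
       (Poly_Mapping.lookup F \<mu>))"

text \<open>
  The \<open>2n\<close> variables \<open>x\<^sub>1, \<dots>, x\<^sub>n, y\<^sub>1, \<dots>, y\<^sub>n\<close> are indexed by the sum type \<open>'n + 'n\<close>, with \<open>Inl\<close> for
  the \<open>x\<^sub>i\<close> and \<open>Inr\<close> for the \<open>y\<^sub>i\<close>.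
\<close>

definition grad_prod :: "'n::finite rpoly \<Rightarrow> ('n + 'n) rpoly" where
  "grad_prod f = (\<Sum>i\<in>UNIV. rename Inl (partial i f) * rename Inr (partial i f))"

definition vjoin :: "real ^ 'n \<Rightarrow> real ^ 'n \<Rightarrow> real ^ ('n + 'n)" where
  "vjoin x y = (\<chi> k. case k of Inl i \<Rightarrow> x $ i | Inr i \<Rightarrow> y $ i)"

text \<open>The infimum over the empty set is \<open>\<infinity>\<close>. The norm on \<open>complex ^ 'v\<close> is the Euclidean one.\<close>

definition dist_C :: "real ^ 'v::finite \<Rightarrow> 'v rpoly \<Rightarrow> ennreal" where
  "dist_C p F = (INF z \<in> {z :: complex ^ 'v. peval F z = 0}.
     ennreal (dist (\<chi> i. complex_of_real (p $ i)) z))"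

text \<open>An axis-aligned cube is given by its midpoint and its width.\<close>

type_synonym 'n cube = "(real ^ 'n) \<times> real"

definition cube_set :: "'n::finite cube \<Rightarrow> (real ^ 'n) set" where
  "cube_set Q = (case Q of (m, w) \<Rightarrow> {x. \<forall>i. m $ i - w / 2 \<le> x $ i \<and> x $ i \<le> m $ i + w / 2})"

definition cube_square :: "'n::finite cube \<Rightarrow> ('n + 'n) cube" where
  "cube_square Q = (case Q of (m, w) \<Rightarrow> (vjoin m m, w))"

definition subcubes :: "'n::finite cube \<Rightarrow> 'n cube set" where
  "subcubes Q = (case Q of (m, w) \<Rightarrow>
     {(m + (w / 4) *\<^sub>R e, w / 2) | e. \<forall>i. e $ i = -1 \<or> e $ i = 1})"

definition centered_form :: "'v::finite rpoly \<Rightarrow> 'v cube \<Rightarrow> real set" where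
  "centered_form F Q = (case Q of (m, w) \<Rightarrow>
     (\<lambda>t. peval F m +
        (\<Sum>\<alpha> | 1 \<le> mdeg \<alpha> \<and> mdeg \<alpha> \<le> pdeg F.
           \<bar>peval (pdiff \<alpha> F) m\<bar> / real (mfact \<alpha>) * (w / 2) ^ mdeg \<alpha>) * t) ` {-1..1})"

definition C0 :: "'n::finite rpoly \<Rightarrow> 'n cube \<Rightarrow> bool" where
  "C0 f J \<longleftrightarrow> 0 \<notin> centered_form f J"

definition C1 :: "'n::finite rpoly \<Rightarrow> 'n cube \<Rightarrow> bool" where
  "C1 f J \<longleftrightarrow> 0 \<notin> centered_form (grad_prod f) (cube_square J)"

definition terminal :: "'n::finite rpoly \<Rightarrow> 'n cube set \<Rightarrow> bool" where
  "terminal f P \<longleftrightarrow> (\<forall>J\<in>P. C0 f J \<or> C1 f J)"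

definition subdiv_step :: "'n::finite rpoly \<Rightarrow> 'n cube set \<Rightarrow> 'n cube set \<Rightarrow> bool" where
  "subdiv_step f P P' \<longleftrightarrow>
     (\<exists>J\<in>P. \<not> C0 f J \<and> \<not> C1 f J \<and> P' = (P - {J}) \<union> subcubes J)"

text \<open>
  The algorithm leaves open which failing cube is subdivided next, so \<open>s\<close> is a run for any
  choice of these cubes. A run that has reached a terminal partition stays there.
\<close>

definition PV_run :: "'n::finite rpoly \<Rightarrow> 'n cube \<Rightarrow> (nat \<Rightarrow> 'n cube set) \<Rightarrow> bool" where
  "PV_run f I s \<longleftrightarrow> s 0 = {I} \<and>
     (\<forall>k. if terminal f (s k) then s (Suc k) = s k else subdiv_step f (s k) (s (Suc k)))"

definition PV_terminates :: "'n::finite rpoly \<Rightarrow> (nat \<Rightarrow> 'n cube set) \<Rightarrow> bool" where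
  "PV_terminates f s \<longleftrightarrow> (\<exists>k. terminal f (s k))"

lemma PV_run_exists: "\<exists>s. PV_run f I s"
proof -
  have "\<exists>P'. if terminal f P then P' = P else subdiv_step f P P'" for P
    by (auto simp: terminal_def subdiv_step_def)
  then obtain h where h: "\<And>P. if terminal f P then h P = P else subdiv_step f P (h P)"
    by metis
  have "PV_run f I (\<lambda>k. (h ^^ k) {I})"
    using h by (auto simp: PV_run_def)
  then show ?thesis by blast
qed

lemma finite_subcubes: "finite (subcubes Q)"
proof -
  let ?E = "{e :: real ^ 'a. \<forall>i. e $ i = -1 \<or> e $ i = 1}"
  have "finite (vec_nth ` ?E)"
    by (rule finite_subset[of _ "PiE UNIV (\<lambda>_. {-1, 1})"]) (auto intro!: finite_PiE)
  then have "finite ?E"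
    by (rule finite_imageD) (auto simp: inj_on_def vec_eq_iff)
  moreover have "subcubes Q = (\<lambda>e. (fst Q + (snd Q / 4) *\<^sub>R e, snd Q / 2)) ` ?E"
    by (auto simp: subcubes_def split: prod.splits)
  ultimately show ?thesis by simp
qed

lemma PV_run_finite:
  assumes "PV_run f I s" shows "finite (s k)"
proof (induction k)
  case 0
  then show ?case using assms by (simp add: PV_run_def)
next
  case (Suc k)
  have "if terminal f (s k) then s (Suc k) = s k else subdiv_step f (s k) (s (Suc k))"
    using assms by (simp add: PV_run_def)
  with Suc show ?case
    by (auto simp: subdiv_step_def finite_subcubes split: if_splits)
qed

lemma finite_mdeg_le: "finite {\<alpha> :: 'v::finite \<Rightarrow>\<^sub>0 nat. mdeg \<alpha> \<le> d}"
proof -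
  let ?A = "{\<alpha> :: 'v \<Rightarrow>\<^sub>0 nat. mdeg \<alpha> \<le> d}"
  have "Poly_Mapping.lookup \<alpha> i \<le> mdeg \<alpha>" for \<alpha> :: "'v \<Rightarrow>\<^sub>0 nat" and i
    unfolding mdeg_def by (rule member_le_sum) auto
  then have "Poly_Mapping.lookup ` ?A \<subseteq> PiE UNIV (\<lambda>_. {..d})"
    by (fastforce intro: order_trans)
  then have "finite (Poly_Mapping.lookup ` ?A)"
    by (rule finite_subset) (auto intro!: finite_PiE)
  then show ?thesis
    by (rule finite_imageD) (simp add: inj_on_def Poly_Mapping.lookup_inject)
qed

lemma peval_superset:
  assumes "finite A" "Poly_Mapping.keys F \<subseteq> A"
  shows "peval F z = (\<Sum>\<mu>\<in>A.
     of_real (Poly_Mapping.lookup F \<mu>) * (\<Prod>i\<in>UNIV. (z $ i) ^ Poly_Mapping.lookup \<mu> i))"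
  unfolding peval_def
  by (rule sum.mono_neutral_left) (use assms in \<open>auto simp: in_keys_iff\<close>)

lemma peval_single [simp]:
  "peval (Poly_Mapping.single \<mu> c) z = of_real c * (\<Prod>i\<in>UNIV. (z $ i) ^ Poly_Mapping.lookup \<mu> i)"
  by (subst peval_superset[of "{\<mu>}"]) (auto simp: lookup_single)

lemma peval_zero [simp]: "peval 0 z = 0"
  by (simp add: peval_def)

lemma peval_add [simp]: "peval (F + G) z = peval F z + peval G z"
proof -
  let ?A = "Poly_Mapping.keys F \<union> Poly_Mapping.keys G"
  have "Poly_Mapping.keys (F + G) \<subseteq> ?A" by (rule Poly_Mapping.keys_add)
  then show ?thesis
    by (simp add: peval_superset[of ?A] lookup_add distrib_right sum.distrib)
qed

lemma peval_sum [simp]: "peval (sum G A) z = (\<Sum>a\<in>A. peval (G a) z)"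
  by (induction A rule: infinite_finite_induct) auto

lemma rpoly_expand:
  fixes F :: "'v rpoly"
  shows "(\<Sum>\<mu>\<in>Poly_Mapping.keys F. Poly_Mapping.single \<mu> (Poly_Mapping.lookup F \<mu>)) = F"
  by (rule poly_mapping_eqI)
     (auto simp: lookup_sum lookup_single when_def in_keys_iff sum.delta)

lemma peval_mult [simp]: "peval (F * G) z = peval F z * peval G z"
proof -
  let ?S = "\<lambda>F \<mu>. Poly_Mapping.single \<mu> (Poly_Mapping.lookup F \<mu>)"
  have "F * G = (\<Sum>\<mu>\<in>Poly_Mapping.keys F. \<Sum>\<nu>\<in>Poly_Mapping.keys G. ?S F \<mu> * ?S G \<nu>)"
    using arg_cong2[OF rpoly_expand[of F, symmetric] rpoly_expand[of G, symmetric], of "(*)"]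
    by (simp only: sum_product)
  then show ?thesis
    by (simp add: mult_single lookup_add power_add prod.distrib sum_product peval_def[of F]
        peval_def[of G] mult.assoc mult.left_commute)
qed

lemma lookup_sum_single:
  "Poly_Mapping.lookup (\<Sum>i\<in>UNIV. Poly_Mapping.single (h i) (c i :: nat)) k
   = (\<Sum>i | h (i::'v::finite) = k. c i)"
  by (simp add: lookup_sum lookup_single when_def sum.If_cases Int_def)

lemma peval_rename: "peval (rename h F) z = peval F (\<chi> i. z $ h i)"
proof -
  have "(\<Prod>k\<in>UNIV. (z $ k) ^ (\<Sum>i | h i = k. c i)) = (\<Prod>i\<in>UNIV. (z $ h i) ^ c i)" for c :: "_ \<Rightarrow> nat"
  proof -
    have "(\<Prod>k\<in>UNIV. (z $ k) ^ (\<Sum>i | h i = k. c i))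
        = (\<Prod>k\<in>UNIV. \<Prod>i | i \<in> UNIV \<and> h i = k. (z $ h i) ^ c i)"
      by (intro prod.cong) (auto simp: power_sum)
    also have "\<dots> = (\<Prod>i\<in>UNIV. (z $ h i) ^ c i)"
      by (rule prod.group) auto
    finally show ?thesis .
  qed
  then show ?thesis
    by (simp add: rename_def lookup_sum_single peval_def[of F])
qed

lemma peval_grad_prod:
  "peval (grad_prod f) (vjoin x y) = (\<Sum>i\<in>UNIV. peval (partial i f) x * peval (partial i f) y)"
  by (simp add: grad_prod_def peval_rename vjoin_def)

lemma pdiff_sum_superset:
  assumes "finite A" "Poly_Mapping.keys F \<subseteq> A"
  shows "pdiff \<alpha> F = (\<Sum>\<mu>\<in>A.
     Poly_Mapping.single (\<mu> - \<alpha>)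
       (real (\<Prod>i\<in>UNIV. fact (Poly_Mapping.lookup \<alpha> i) *
                 (Poly_Mapping.lookup \<mu> i choose Poly_Mapping.lookup \<alpha> i))
        * Poly_Mapping.lookup F \<mu>))"
  unfolding pdiff_def
  by (rule sum.mono_neutral_left) (use assms in \<open>auto simp: in_keys_iff\<close>)

lemma pdiff_single:
  "pdiff \<alpha> (Poly_Mapping.single \<mu> c) = Poly_Mapping.single (\<mu> - \<alpha>)
     (real (\<Prod>i\<in>UNIV. fact (Poly_Mapping.lookup \<alpha> i) *
        (Poly_Mapping.lookup \<mu> i choose Poly_Mapping.lookup \<alpha> i)) * c)"
  by (subst pdiff_sum_superset[of "{\<mu>}"]) (auto simp: lookup_single)

lemma pdiff_zero [simp]: "pdiff \<alpha> 0 = 0"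
  by (simp add: pdiff_def)

lemma pdiff_plus: "pdiff \<alpha> (F + G) = pdiff \<alpha> F + pdiff \<alpha> G"
proof -
  let ?A = "Poly_Mapping.keys F \<union> Poly_Mapping.keys G"
  have "Poly_Mapping.keys (F + G) \<subseteq> ?A" by (rule Poly_Mapping.keys_add)
  then show ?thesis
    by (simp add: pdiff_sum_superset[of ?A] lookup_add distrib_left sum.distrib single_add)
qed

lemma pdiff_sum: "pdiff \<alpha> (sum G A) = (\<Sum>a\<in>A. pdiff \<alpha> (G a))"
  by (induction A rule: infinite_finite_induct) (auto simp: pdiff_plus)

lemma fact_binomial_add:
  "fact (a + b) * (m choose (a + b)) = fact b * (m choose b) * (fact a * ((m - b) choose a))"
  for a b m :: nat
proof (cases "a + b \<le> m")
  case True
  have *: "fact k * (n choose k) * fact (n - k) = (fact n :: nat)" if "k \<le> n" for k n :: nat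
    using binomial_fact_lemma[OF that] by (simp add: mult_ac)
  have "fact b * (m choose b) * (fact a * ((m - b) choose a)) * fact (m - b - a)
      = fact b * (m choose b) * (fact a * ((m - b) choose a) * fact (m - b - a))"
    by (simp add: mult_ac)
  also have "\<dots> = fact b * (m choose b) * fact (m - b)"
    using True by (subst *) auto
  also have "\<dots> = fact m" using True by (subst *) auto
  also have "\<dots> = fact (a + b) * (m choose (a + b)) * fact (m - (a + b))"
    using True by (subst *) auto
  finally show ?thesis by (simp add: diff_diff_left add.commute)
next
  case False
  then show ?thesis by (cases "b \<le> m") (auto simp: binomial_eq_0)
qed

lemma pdiff_0 [simp]: "pdiff 0 F = F"
  by (simp add: pdiff_def rpoly_expand)

lemma pdiff_add: "pdiff (\<alpha> + \<beta>) F = pdiff \<alpha> (pdiff \<beta> F)"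
  by (simp add: pdiff_def[of _ F] pdiff_sum pdiff_single lookup_add fact_binomial_add
      prod.distrib lookup_minus diff_diff_add add.commute mult_ac)

lemma has_partial_derivative:
  fixes x :: "real ^ 'v::finite"
  shows "((\<lambda>t. peval F (x + t *\<^sub>R axis i 1)) has_real_derivative peval (partial i F) x) (at 0)"
proof -
  have mono: "((\<lambda>t. \<Prod>j\<in>UNIV. ((x + t *\<^sub>R axis i 1) $ j) ^ Poly_Mapping.lookup \<mu> j)
      has_real_derivative
        real (\<Prod>j\<in>UNIV. fact (Poly_Mapping.lookup (Poly_Mapping.single i 1) j) *
           (Poly_Mapping.lookup \<mu> j choose Poly_Mapping.lookup (Poly_Mapping.single i 1) j)) *
        (\<Prod>j\<in>UNIV. (x $ j) ^ Poly_Mapping.lookup (\<mu> - Poly_Mapping.single i 1) j)) (at 0)"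
    (is "(?f has_real_derivative ?d) _") for \<mu> :: "'v \<Rightarrow>\<^sub>0 nat"
  proof -
    let ?m = "Poly_Mapping.lookup \<mu>"
    let ?r = "\<Prod>j\<in>UNIV - {i}. (x $ j) ^ ?m j"
    have f: "?f = (\<lambda>t. (x $ i + t) ^ ?m i * ?r)"
      by (rule ext, subst prod.remove[of _ i]) (auto simp: axis_def intro!: prod.cong)
    have "(\<Prod>j\<in>UNIV. fact (Poly_Mapping.lookup (Poly_Mapping.single i 1) j) *
           (?m j choose Poly_Mapping.lookup (Poly_Mapping.single i 1) j)) = ?m i"
      by (subst prod.remove[of _ i]) (auto simp: lookup_single when_def)
    moreover have "(\<Prod>j\<in>UNIV. (x $ j) ^ Poly_Mapping.lookup (\<mu> - Poly_Mapping.single i 1) j)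
        = (x $ i) ^ (?m i - 1) * ?r"
      by (subst prod.remove[of _ i])
         (auto simp: lookup_minus lookup_single when_def intro!: prod.cong)
    ultimately have d: "?d = real (?m i) * ((x $ i) ^ (?m i - 1) * ?r)"
      by simp
    show ?thesis unfolding f d
      by (auto intro!: derivative_eq_intros)
  qed
  have eq: "peval (partial i F) x = (\<Sum>\<mu>\<in>Poly_Mapping.keys F. Poly_Mapping.lookup F \<mu> *
     (real (\<Prod>j\<in>UNIV. fact (Poly_Mapping.lookup (Poly_Mapping.single i 1) j) *
           (Poly_Mapping.lookup \<mu> j choose Poly_Mapping.lookup (Poly_Mapping.single i 1) j)) *
        (\<Prod>j\<in>UNIV. (x $ j) ^ Poly_Mapping.lookup (\<mu> - Poly_Mapping.single i 1) j)))"
    by (simp add: pdiff_def mult_ac)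
  show ?thesis
    unfolding eq unfolding peval_def of_real_eq_id id_apply
    by (intro DERIV_sum DERIV_cmult mono)
qed

end

theory Submission
  imports Defs "HOL-Computational_Algebra.Fundamental_Theorem_Algebra" "HOL-Library.Real_Mod"
begin

text \<open>
  If \<open>F\<close> has no complex zero within distance \<open>r\<close> of \<open>m\<close>, then on each complex line through \<open>m\<close> it
  factors into linear factors with roots far from \<open>m\<close>. This bounds the homogeneous parts of the
  Taylor expansion at \<open>m\<close>, and averaging over a torus bounds its single coefficients. Summation over
  the exponents shows that the centered form excludes 0 on every cube that is small relative to \<open>r\<close>.
  Hence on a cube that fails both tests the integrand is at least the inverse of its volume, and each
  child of such a cube contributes at least \<open>2\<^sup>-\<^sup>n\<close> to the integral. This bounds the size of every
  partition that occurs, so a finite integral forces termination. Conversely, a test that succeeds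
  keeps the zero set away from the compact cube, so that the integrand is bounded there.
\<close>

section \<open>Coefficient bounds from zero-free regions\<close>

text \<open>All roots have modulus at least \<open>r\<close>, so the coefficients are dominated by
  those of p(0) (1 + z/r)^D. The induction splits off one linear factor, and Pascal's rule joins the
  two resulting terms.\<close>

lemma poly_coeff_bound_zero_free:
  fixes p :: "complex poly"
  assumes "degree p \<le> D" "0 < r" "\<And>z. cmod z < r \<Longrightarrow> poly p z \<noteq> 0"
  shows "cmod (coeff p k) * r ^ k \<le> cmod (coeff p 0) * real (D choose k)"
  using assms
proof (induction D arbitrary: p k)
  case 0
  then show ?case by (cases k) (auto simp: coeff_eq_0)
next
  case (Suc D)
  show ?case
  proof (cases "degree p = 0")
    case True
    then show ?thesis by (cases k) (auto simp: coeff_eq_0)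
  next
    case False
    then have "\<not> constant (poly p)" by (simp add: constant_degree)
    then obtain z where z: "poly p z = 0"
      using fundamental_theorem_of_algebra by blast
    then obtain q where q: "p = [:- z, 1:] * q"
      by (metis poly_eq_0_iff_dvd dvdE)
    have "q \<noteq> 0" using False q by auto
    then have "degree p = Suc (degree q)"
      unfolding q by (subst degree_mult_eq) auto
    then have deg: "degree q \<le> D" using Suc.prems by simp
    have "poly q w \<noteq> 0" if "cmod w < r" for w
      using Suc.prems(3)[OF that] by (auto simp: q)
    then have IH: "cmod (coeff q j) * r ^ j \<le> cmod (coeff q 0) * real (D choose j)" for j
      using Suc.IH[OF deg \<open>0 < r\<close>] by blast
    have rz: "r \<le> cmod z" using Suc.prems(3)[of z] z by force
    have p0: "coeff p 0 = - z * coeff q 0" by (simp add: q)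
    show ?thesis
    proof (cases k)
      case 0
      then show ?thesis by simp
    next
      case (Suc j)
      have "coeff p k = coeff q j - z * coeff q (Suc j)"
        by (simp add: q Suc)
      then have "cmod (coeff p k) \<le> cmod (coeff q j) + cmod z * cmod (coeff q (Suc j))"
        by (metis norm_mult norm_triangle_ineq4)
      then have "cmod (coeff p k) * r ^ k
          \<le> (cmod (coeff q j) + cmod z * cmod (coeff q (Suc j))) * r ^ k"
        using \<open>0 < r\<close> by (intro mult_right_mono) auto
      also have "\<dots> = r * (cmod (coeff q j) * r ^ j)
          + cmod z * (cmod (coeff q (Suc j)) * r ^ Suc j)"
        by (simp add: Suc algebra_simps)
      \<comment> \<open>The spare factor \<open>r\<close> is raised to \<open>cmod z\<close>, so
        that both terms carry |p(0)| = |z| |q(0)|.\<close>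
      also have "\<dots> \<le> cmod z * (cmod (coeff q 0) * real (D choose j))
          + cmod z * (cmod (coeff q 0) * real (D choose Suc j))"
        using \<open>0 < r\<close> by (intro add_mono mult_mono IH rz) auto
      also have "\<dots> = cmod (coeff p 0) * real (Suc D choose k)"
        by (simp add: p0 Suc norm_mult algebra_simps)
      finally show ?thesis .
    qed
  qed
qed

section \<open>Monomials and averages over roots of unity\<close>

definition mmono :: "('v::finite \<Rightarrow>\<^sub>0 nat) \<Rightarrow> 'a::comm_semiring_1 ^ 'v \<Rightarrow> 'a" where
  "mmono \<alpha> u = (\<Prod>i\<in>UNIV. (u $ i) ^ Poly_Mapping.lookup \<alpha> i)"

lemma lookup_le_mdeg: "Poly_Mapping.lookup \<alpha> i \<le> mdeg \<alpha>"
  unfolding mdeg_def by (rule member_le_sum) auto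

lemma mmono_smult: "mmono \<alpha> (c *s u) = c ^ mdeg \<alpha> * mmono \<alpha> u"
  for u :: "'a::comm_ring_1 ^ 'v::finite"
  by (simp add: mmono_def mdeg_def power_mult_distrib prod.distrib power_sum)

text \<open>
  The coefficient of \<open>u\<^sup>\<alpha>\<close> is the average of the polynomial times \<open>u\<^sup>-\<^sup>\<alpha>\<close> over all points whose
  coordinates are \<open>M\<close>-th roots of unity, provided \<open>M\<close> exceeds all exponents.
\<close>

lemma torus_coeff_bound:
  fixes c :: "('v::finite \<Rightarrow>\<^sub>0 nat) \<Rightarrow> complex"
  assumes "finite A" "\<alpha> \<in> A"
    and bound: "\<And>u :: complex ^ 'v. (\<And>i. cmod (u $ i) = 1) \<Longrightarrow>
      cmod (\<Sum>\<beta>\<in>A. c \<beta> * mmono \<beta> u) \<le> B"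
  shows "cmod (c \<alpha>) \<le> B"
proof -
  define M where "M = Suc (\<Sum>\<beta>\<in>A. mdeg \<beta>)"
  define \<omega> where "\<omega> = cis (2 * pi / M)"
  define S where "S = (PiE UNIV (\<lambda>_. {..<M}) :: ('v \<Rightarrow> nat) set)"
  define u where "u j = (\<chi> i. \<omega> ^ j i)" for j :: "'v \<Rightarrow> nat"
  \<comment> \<open>This is \<open>\<omega>\<close> to the power \<beta>_i - \<alpha>_i. Since
    \<open>\<omega>\<close> has modulus 1, its conjugate serves as inverse and negative exponents
    are avoided.\<close>
  define q where "q \<beta> i = \<omega> ^ Poly_Mapping.lookup \<beta> i * cnj \<omega> ^ Poly_Mapping.lookup \<alpha> i"
    for \<beta> :: "'v \<Rightarrow>\<^sub>0 nat" and i
  have less: "Poly_Mapping.lookup \<beta> i < M" if "\<beta> \<in> A" for \<beta> i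
  proof -
    have "mdeg \<beta> \<le> (\<Sum>\<beta>\<in>A. mdeg \<beta>)"
      using assms(1) that by (intro member_le_sum) auto
    with lookup_le_mdeg[of \<beta> i] show ?thesis by (simp add: M_def)
  qed
  have M: "M > 0" by (simp add: M_def)
  have q_cis: "q \<beta> i = cis (2 * pi * (real (Poly_Mapping.lookup \<beta> i) - real (Poly_Mapping.lookup \<alpha> i)) / M)"
    for \<beta> i
    by (simp only: q_def \<omega>_def Complex.DeMoivre cis_mult cis_cnj)
      (rule arg_cong[where f = cis], simp add: algebra_simps diff_divide_distrib)
  have geo: "(\<Sum>l<M. q \<beta> i ^ l) = (if Poly_Mapping.lookup \<beta> i = Poly_Mapping.lookup \<alpha> i then of_nat M else 0)"
    if "\<beta> \<in> A" for \<beta> i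
  proof (cases "Poly_Mapping.lookup \<beta> i = Poly_Mapping.lookup \<alpha> i")
    case True
    then show ?thesis by (simp add: q_cis)
  next
    case False
    let ?b = "int (Poly_Mapping.lookup \<beta> i)" and ?a = "int (Poly_Mapping.lookup \<alpha> i)"
    have "q \<beta> i ^ M = cis (2 * pi * real_of_int (?b - ?a))"
      using M by (simp add: q_cis Complex.DeMoivre)
    then have qM: "q \<beta> i ^ M = 1" by (simp add: cis_multiple_2pi del: of_int_diff)
    \<comment> \<open>Otherwise \<open>M\<close> would divide a nonzero difference of two exponents
      that are both below \<open>M\<close>.\<close>
    have "q \<beta> i \<noteq> 1"
    proof
      assume "q \<beta> i = 1"
      then obtain k :: int where
        "2 * pi * (real_of_int ?b - real_of_int ?a) / M = of_int k * (2 * pi)"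
        by (auto simp: q_cis cis_eq_1_iff)
      then have "(2 * pi) * real_of_int (?b - ?a) = (2 * pi) * real_of_int (k * int M)"
        using M by (simp add: field_simps)
      then have "real_of_int (?b - ?a) = real_of_int (k * int M)"
        by (rule mult_left_cancel[of "2 * pi", THEN iffD1, rotated]) simp
      then have k: "?b - ?a = k * int M" by (simp only: of_int_eq_iff)
      have "\<bar>?b - ?a\<bar> < int M" using less[OF that, of i] less[OF assms(2), of i] by linarith
      then have "\<bar>k\<bar> * int M < 1 * int M" by (simp add: k abs_mult)
      then have "k = 0" using M by (simp add: mult_less_cancel_right)
      with k False show False by simp
    qed
    with qM False show ?thesis by (simp add: sum_gp_strict)
  qed
  have mono: "mmono \<beta> (u j) * cnj (mmono \<alpha> (u j)) = (\<Prod>i\<in>UNIV. q \<beta> i ^ j i)" for \<beta> j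
    by (simp add: mmono_def u_def q_def power_mult_distrib prod.distrib power_mult[symmetric]
        mult.commute)
  \<comment> \<open>Discrete orthogonality: the sum over the torus factors into coordinates, and one
    coordinate with different exponents makes the product vanish.\<close>
  have avg: "(\<Sum>j\<in>S. mmono \<beta> (u j) * cnj (mmono \<alpha> (u j)))
      = (if \<beta> = \<alpha> then of_nat M ^ CARD('v) else 0)" if "\<beta> \<in> A" for \<beta>
  proof -
    have "(\<Sum>j\<in>S. mmono \<beta> (u j) * cnj (mmono \<alpha> (u j))) = (\<Prod>i\<in>UNIV. \<Sum>l<M. q \<beta> i ^ l)"
      unfolding mono S_def by (subst prod_sum_PiE) auto
    also have "\<dots> = (\<Prod>i\<in>UNIV. if Poly_Mapping.lookup \<beta> i = Poly_Mapping.lookup \<alpha> i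
        then of_nat M else 0)"
      using geo[OF that] by simp
    also have "\<dots> = (if \<beta> = \<alpha> then of_nat M ^ CARD('v) else 0)"
    proof (cases "\<beta> = \<alpha>")
      case False
      then obtain i where "Poly_Mapping.lookup \<beta> i \<noteq> Poly_Mapping.lookup \<alpha> i"
        by (meson poly_mapping_eqI)
      then show ?thesis using False by (auto intro!: prod_zero)
    qed simp
    finally show ?thesis .
  qed
  have card_S: "card S = M ^ CARD('v)" and fin_S: "finite S"
    by (auto simp: S_def card_PiE intro!: finite_PiE)
  have unit: "cmod (u j $ i) = 1" for j i
    by (simp add: u_def \<omega>_def norm_power)
  have "c \<alpha> * of_nat M ^ CARD('v)
      = (\<Sum>\<beta>\<in>A. c \<beta> * (if \<beta> = \<alpha> then of_nat M ^ CARD('v) else 0))"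
    using assms(1,2) by (simp add: if_distrib cong: if_cong)
  also have "\<dots> = (\<Sum>\<beta>\<in>A. c \<beta> * (\<Sum>j\<in>S. mmono \<beta> (u j) * cnj (mmono \<alpha> (u j))))"
    by (intro sum.cong refl) (simp add: avg)
  also have "\<dots> = (\<Sum>j\<in>S. (\<Sum>\<beta>\<in>A. c \<beta> * mmono \<beta> (u j)) * cnj (mmono \<alpha> (u j)))"
    unfolding sum_distrib_left sum_distrib_right by (subst sum.swap) (simp add: mult.assoc)
  finally have "cmod (c \<alpha>) * real M ^ CARD('v)
      = cmod (\<Sum>j\<in>S. (\<Sum>\<beta>\<in>A. c \<beta> * mmono \<beta> (u j)) * cnj (mmono \<alpha> (u j)))"
    by (metis norm_mult norm_of_nat norm_power)
  also have "\<dots> \<le> (\<Sum>j\<in>S. cmod (\<Sum>\<beta>\<in>A. c \<beta> * mmono \<beta> (u j)) * cmod (mmono \<alpha> (u j)))"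
    by (rule order_trans[OF norm_sum]) (simp add: norm_mult)
  also have "\<dots> \<le> (\<Sum>j\<in>S. B)"
  proof (rule sum_mono)
    fix j
    have "cmod (mmono \<alpha> (u j)) = 1"
      using unit by (simp add: mmono_def norm_power flip: prod_norm)
    then show "cmod (\<Sum>\<beta>\<in>A. c \<beta> * mmono \<beta> (u j)) * cmod (mmono \<alpha> (u j)) \<le> B"
      using bound[of "u j"] unit by simp
  qed
  also have "\<dots> = B * real M ^ CARD('v)" by (simp add: card_S)
  finally show ?thesis using M by simp
qed

text \<open>Stars and bars, with the binomial coefficient bounded by a power of 2. The factor
  \<open>2 ^ k\<close> is kept apart because it later merges with the other k-th powers.\<close>

lemma card_mdeg_eq_le: "card {\<alpha> :: 'v::finite \<Rightarrow>\<^sub>0 nat. mdeg \<alpha> = k} \<le> 2 ^ (CARD('v) - 1) * 2 ^ k"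
proof -
  obtain xs :: "'v list" where xs: "set xs = UNIV" "distinct xs"
    using finite_distinct_list[of "UNIV :: 'v set"] by auto
  then have len: "length xs = CARD('v)" by (metis distinct_card)
  have pos: "CARD('v) > 0" by simp
  let ?h = "\<lambda>\<alpha>. map (Poly_Mapping.lookup \<alpha>) xs"
  let ?L = "{l :: nat list. length l = CARD('v) \<and> sum_list l = k}"
  have "finite ?L"
  proof (rule finite_subset)
    show "?L \<subseteq> {l. set l \<subseteq> {..k} \<and> length l = CARD('v)}"
      by (auto simp: member_le_sum_list)
    show "finite {l. set l \<subseteq> {..k} \<and> length l = CARD('v)}"
      by (rule finite_lists_length_eq) simp
  qed
  moreover have "inj_on ?h {\<alpha>. mdeg \<alpha> = k}"
    using xs by (auto simp: inj_on_def intro!: poly_mapping_eqI)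
  moreover have "?h ` {\<alpha>. mdeg \<alpha> = k} \<subseteq> ?L"
    using xs by (auto simp: len mdeg_def sum_list_distinct_conv_sum_set)
  ultimately have "card {\<alpha> :: 'v \<Rightarrow>\<^sub>0 nat. mdeg \<alpha> = k} \<le> card ?L"
    by (intro card_inj_on_le[of ?h])
  also have "\<dots> = (k + CARD('v) - 1) choose k" by (rule card_length_sum_list)
  also have "\<dots> \<le> 2 ^ (k + CARD('v) - 1)" by (rule binomial_le_pow2)
  also have "\<dots> = 2 ^ (CARD('v) - 1) * 2 ^ k"
    using pos by (simp flip: power_add add: add.commute)
  finally show ?thesis .
qed

section \<open>Taylor expansion and the centered form\<close>

definition taylor_coeff :: "'v::finite rpoly \<Rightarrow> 'a::real_field ^ 'v \<Rightarrow> ('v \<Rightarrow>\<^sub>0 nat) \<Rightarrow> 'a" where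
  "taylor_coeff F z \<alpha> = peval (pdiff \<alpha> F) z / of_nat (mfact \<alpha>)"

lemma mdeg_le_pdeg: "\<mu> \<in> Poly_Mapping.keys F \<Longrightarrow> mdeg \<mu> \<le> pdeg F"
  unfolding pdeg_def by (intro Max_ge) auto

lemma pdeg_leI: "(\<And>\<mu>. \<mu> \<in> Poly_Mapping.keys F \<Longrightarrow> mdeg \<mu> \<le> k) \<Longrightarrow> pdeg F \<le> k"
  unfolding pdeg_def by (subst Max_le_iff) auto

lemma mdeg_eq_0_iff: "mdeg \<alpha> = 0 \<longleftrightarrow> \<alpha> = 0"
  by (auto simp: mdeg_def intro: poly_mapping_eqI)

text \<open>The binomial theorem in each coordinate. \<open>A\<close> may contain further exponents,
  since their binomial coefficients vanish; thus one index set serves all monomials of a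
  polynomial.\<close>

lemma mmono_add:
  fixes z u :: "'a::comm_ring_1 ^ 'v::finite"
  assumes "finite A" "\<And>\<alpha>. (\<And>i. Poly_Mapping.lookup \<alpha> i \<le> Poly_Mapping.lookup \<mu> i) \<Longrightarrow> \<alpha> \<in> A"
  shows "mmono \<mu> (z + u) = (\<Sum>\<alpha>\<in>A.
     of_nat (\<Prod>i\<in>UNIV. Poly_Mapping.lookup \<mu> i choose Poly_Mapping.lookup \<alpha> i)
       * mmono (\<mu> - \<alpha>) z * mmono \<alpha> u)"
proof -
  let ?m = "Poly_Mapping.lookup \<mu>"
  let ?T = "\<lambda>g. \<Prod>i\<in>UNIV. of_nat (?m i choose g i) * (u $ i) ^ g i * (z $ i) ^ (?m i - g i)"
  let ?B = "{\<alpha>. \<forall>i. Poly_Mapping.lookup \<alpha> i \<le> ?m i}"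
  have "mmono \<mu> (z + u) = (\<Prod>i\<in>UNIV. (u $ i + z $ i) ^ ?m i)"
    by (simp add: mmono_def add.commute)
  also have "\<dots> = (\<Sum>g\<in>PiE UNIV (\<lambda>i. {..?m i}). ?T g)"
    unfolding binomial_ring by (subst prod_sum_PiE) auto
  also have "\<dots> = (\<Sum>\<alpha>\<in>?B. ?T (Poly_Mapping.lookup \<alpha>))"
  proof (rule sum.reindex_bij_betw[symmetric])
    show "bij_betw Poly_Mapping.lookup ?B (PiE UNIV (\<lambda>i. {..?m i}))"
    proof (rule bij_betwI')
      fix g assume "g \<in> PiE UNIV (\<lambda>i. {..?m i})"
      \<comment> \<open>Every function on a finite index type has finite support, hence is an
        exponent.\<close>
      then have "Abs_poly_mapping g \<in> ?B" "g = Poly_Mapping.lookup (Abs_poly_mapping g)"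
        by auto
      then show "\<exists>\<alpha>\<in>?B. g = Poly_Mapping.lookup \<alpha>" by blast
    qed (auto simp: Poly_Mapping.lookup_inject)
  qed
  also have "\<dots> = (\<Sum>\<alpha>\<in>A. ?T (Poly_Mapping.lookup \<alpha>))"
  proof (rule sum.mono_neutral_left)
    show "\<forall>\<alpha>\<in>A - ?B. ?T (Poly_Mapping.lookup \<alpha>) = 0"
    proof
      fix \<alpha> assume "\<alpha> \<in> A - ?B"
      then obtain i where "?m i < Poly_Mapping.lookup \<alpha> i" by (auto simp: not_le)
      then show "?T (Poly_Mapping.lookup \<alpha>) = 0"
        by (intro prod_zero bexI[of _ i]) (auto simp: binomial_eq_0)
    qed
  qed (use assms in auto)
  finally show ?thesis
    by (simp add: mmono_def prod.distrib lookup_minus mult_ac)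
qed

text \<open>Expand each monomial and swap the sums. The field stays general: the expansion is used
  over the complex numbers on lines and over the reals on cubes.\<close>

lemma peval_taylor:
  fixes z u :: "'a::real_field ^ 'v::finite"
  shows "peval F (z + u) = (\<Sum>\<alpha> | mdeg \<alpha> \<le> pdeg F. taylor_coeff F z \<alpha> * mmono \<alpha> u)"
proof -
  let ?A = "{\<alpha> :: 'v \<Rightarrow>\<^sub>0 nat. mdeg \<alpha> \<le> pdeg F}"
  let ?C = "\<lambda>\<mu> \<alpha>. of_nat (\<Prod>i\<in>UNIV. Poly_Mapping.lookup \<mu> i choose Poly_Mapping.lookup \<alpha> i) :: 'a"
  \<comment> \<open>The factorials in \<open>pdiff\<close> cancel against \<open>mfact\<close>,
    which leaves the binomial coefficients of \<open>mmono_add\<close>.\<close>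
  have coeff: "taylor_coeff F z \<alpha> = (\<Sum>\<mu>\<in>Poly_Mapping.keys F.
      of_real (Poly_Mapping.lookup F \<mu>) * (?C \<mu> \<alpha> * mmono (\<mu> - \<alpha>) z))" for \<alpha>
  proof -
    have nz: "of_nat (mfact \<alpha>) \<noteq> (0 :: 'a)" by (simp add: mfact_def)
    have "peval (pdiff \<alpha> F) z = of_nat (mfact \<alpha>) * (\<Sum>\<mu>\<in>Poly_Mapping.keys F.
      of_real (Poly_Mapping.lookup F \<mu>) * (?C \<mu> \<alpha> * mmono (\<mu> - \<alpha>) z))"
      unfolding pdiff_def peval_sum peval_single sum_distrib_left
      by (intro sum.cong refl) (simp add: mmono_def mfact_def prod.distrib)
    with nz show ?thesis by (simp add: taylor_coeff_def)
  qed
  have "peval F (z + u) = (\<Sum>\<mu>\<in>Poly_Mapping.keys F. of_real (Poly_Mapping.lookup F \<mu>) *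
      (\<Sum>\<alpha>\<in>?A. ?C \<mu> \<alpha> * mmono (\<mu> - \<alpha>) z * mmono \<alpha> u))"
    unfolding peval_def mmono_def[symmetric]
  proof (intro sum.cong refl arg_cong2[where f = "(*)"] mmono_add finite_mdeg_le)
    fix \<mu> \<alpha> :: "'v \<Rightarrow>\<^sub>0 nat"
    assume "\<mu> \<in> Poly_Mapping.keys F"
      and "\<And>i. Poly_Mapping.lookup \<alpha> i \<le> Poly_Mapping.lookup \<mu> i"
    then have "mdeg \<alpha> \<le> mdeg \<mu>" "mdeg \<mu> \<le> pdeg F"
      by (auto simp: mdeg_def mdeg_le_pdeg[unfolded mdeg_def] intro: sum_mono)
    then show "\<alpha> \<in> ?A" by simp
  qed
  also have "\<dots> = (\<Sum>\<alpha>\<in>?A. taylor_coeff F z \<alpha> * mmono \<alpha> u)"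
    unfolding coeff sum_distrib_left sum_distrib_right
    by (subst sum.swap) (simp add: mult.assoc)
  finally show ?thesis .
qed

section \<open>Complex points and bounds for Taylor coefficients\<close>

definition cvec :: "real ^ 'v \<Rightarrow> complex ^ 'v" where
  "cvec x = (\<chi> i. complex_of_real (x $ i))"

lemma peval_cvec: "peval F (cvec x) = complex_of_real (peval F x)"
  by (simp add: peval_def cvec_def)

lemma taylor_coeff_cvec: "taylor_coeff F (cvec x) \<alpha> = complex_of_real (taylor_coeff F x \<alpha>)"
  by (simp add: taylor_coeff_def peval_cvec)

lemma dist_cvec: "dist (cvec x) (cvec y) = dist x y"
  by (simp add: dist_vec_def cvec_def dist_of_real)

lemma norm_smult_complex: "norm (t *s u) = cmod t * norm u"
  for u :: "complex ^ 'v::finite"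
  by (simp add: norm_vec_def norm_mult L2_set_right_distrib)

text \<open>
  On the line through \<open>m\<close> in direction \<open>u\<close>, \<open>F\<close> is a univariate polynomial without zeros in the
  disc of radius \<open>r / \<bar>u\<bar>\<close>; averaging over directions with unimodular entries, which have length
  \<open>\<surd>N\<close>, isolates the single coefficients.
\<close>

lemma taylor_coeff_bound:
  fixes m :: "real ^ 'v::finite"
  assumes "0 < r" and nz: "\<And>z. dist (cvec m) z < r \<Longrightarrow> peval F z \<noteq> 0"
    and "mdeg \<alpha> \<le> pdeg F"
  shows "\<bar>taylor_coeff F m \<alpha>\<bar>
    \<le> \<bar>peval F m\<bar> * real (pdeg F choose mdeg \<alpha>) * (sqrt CARD('v) / r) ^ mdeg \<alpha>"
proof -
  define k where "k = mdeg \<alpha>"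
  define N where "N = real CARD('v)"
  have N: "0 < sqrt N" by (simp add: N_def)
  let ?A = "{\<beta> :: 'v \<Rightarrow>\<^sub>0 nat. mdeg \<beta> \<le> pdeg F}"
  let ?B = "{\<beta> :: 'v \<Rightarrow>\<^sub>0 nat. mdeg \<beta> = k}"
  let ?c = "taylor_coeff F (cvec m)"
  have finB: "finite ?B" by (rule finite_subset[OF _ finite_mdeg_le[of k]]) auto
  have "cmod (?c \<alpha>) \<le> \<bar>peval F m\<bar> * real (pdeg F choose k) * (sqrt N / r) ^ k"
  proof (rule torus_coeff_bound[OF finB])
    show "\<alpha> \<in> ?B" by (simp add: k_def)
    fix u :: "complex ^ 'v"
    assume unit: "\<And>i. cmod (u $ i) = 1"
    have norm_u: "norm u = sqrt N"
      using unit by (simp add: norm_vec_def L2_set_def N_def)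
    \<comment> \<open>The restriction of \<open>F\<close> to the line t -> m + t u. Its coefficient
      at t^k is the homogeneous Taylor part of degree \<open>k\<close>, evaluated at
      \<open>u\<close>.\<close>
    define p where "p = (\<Sum>\<beta>\<in>?A. monom (?c \<beta> * mmono \<beta> u) (mdeg \<beta>))"
    have poly_p: "poly p t = peval F (cvec m + t *s u)" for t
      by (simp add: p_def poly_sum poly_monom peval_taylor mmono_smult mult_ac)
    have "degree p \<le> pdeg F"
      unfolding p_def
      by (intro degree_sum_le finite_mdeg_le) (auto intro: order_trans[OF degree_monom_le])
    moreover have "poly p t \<noteq> 0" if "cmod t < r / sqrt N" for t
    proof -
      have "dist (cvec m) (cvec m + t *s u) = cmod t * sqrt N"
        by (simp add: dist_norm norm_smult_complex norm_u)
      also have "\<dots> < r" using that N by (simp add: field_simps)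
      finally show ?thesis unfolding poly_p by (rule nz)
    qed
    ultimately have "cmod (coeff p k) * (r / sqrt N) ^ k \<le> cmod (coeff p 0) * real (pdeg F choose k)"
      using \<open>0 < r\<close> N by (intro poly_coeff_bound_zero_free) auto
    moreover have "coeff p 0 = complex_of_real (peval F m)"
      using poly_p[of 0] by (simp add: poly_0_coeff_0 peval_cvec)
    moreover have "coeff p k = (\<Sum>\<beta>\<in>?B. ?c \<beta> * mmono \<beta> u)"
    proof -
      have "coeff p k = (\<Sum>\<beta>\<in>?A. if mdeg \<beta> = k then ?c \<beta> * mmono \<beta> u else 0)"
        by (simp add: p_def coeff_sum)
      also have "\<dots> = (\<Sum>\<beta>\<in>?B. if mdeg \<beta> = k then ?c \<beta> * mmono \<beta> u else 0)"
        using assms(3) by (intro sum.mono_neutral_right finite_mdeg_le) (auto simp: k_def)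
      finally show ?thesis by simp
    qed
    ultimately have "cmod (\<Sum>\<beta>\<in>?B. ?c \<beta> * mmono \<beta> u) * (r / sqrt N) ^ k
        \<le> \<bar>peval F m\<bar> * real (pdeg F choose k)"
      by simp
    then show "cmod (\<Sum>\<beta>\<in>?B. ?c \<beta> * mmono \<beta> u)
        \<le> \<bar>peval F m\<bar> * real (pdeg F choose k) * (sqrt N / r) ^ k"
      using \<open>0 < r\<close> N by (simp add: power_divide field_simps)
  qed
  then show ?thesis by (simp add: taylor_coeff_cvec k_def N_def)
qed

definition form_radius :: "'v::finite rpoly \<Rightarrow> real ^ 'v \<Rightarrow> real \<Rightarrow> real" where
  "form_radius F m h = (\<Sum>\<alpha> | 1 \<le> mdeg \<alpha> \<and> mdeg \<alpha> \<le> pdeg F. \<bar>taylor_coeff F m \<alpha>\<bar> * h ^ mdeg \<alpha>)"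

lemma finite_mdeg_ge_1: "finite {\<alpha> :: 'v::finite \<Rightarrow>\<^sub>0 nat. 1 \<le> mdeg \<alpha> \<and> mdeg \<alpha> \<le> d}"
  by (rule finite_subset[OF _ finite_mdeg_le[of d]]) auto

lemma form_radius_nonneg: "0 \<le> h \<Longrightarrow> 0 \<le> form_radius F m h"
  by (auto simp: form_radius_def intro!: sum_nonneg)

text \<open>The centered form is an interval about F(m) with half-length \<open>form_radius\<close>.
  Both tests thus become comparisons of two real numbers.\<close>

lemma zero_in_centered_form_iff:
  assumes "0 \<le> w"
  shows "0 \<in> centered_form F (m, w) \<longleftrightarrow> \<bar>peval F m\<bar> \<le> form_radius F m (w / 2)"
proof -
  let ?R = "form_radius F m (w / 2)"
  have eq: "centered_form F (m, w) = (\<lambda>t. peval F m + ?R * t) ` {-1..1}"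
    by (simp add: centered_form_def form_radius_def taylor_coeff_def)
  have R: "0 \<le> ?R" using assms by (simp add: form_radius_nonneg)
  show ?thesis
  proof
    assume "0 \<in> centered_form F (m, w)"
    then obtain t where "t \<in> {-1..1}" "0 = peval F m + ?R * t" unfolding eq by blast
    then have t: "\<bar>t\<bar> \<le> 1" "peval F m = - (?R * t)" by auto
    then have "\<bar>peval F m\<bar> = ?R * \<bar>t\<bar>" using R by (simp add: abs_mult)
    also have "\<dots> \<le> ?R" using R t(1) by (simp add: mult_left_le)
    finally show "\<bar>peval F m\<bar> \<le> ?R" .
  next
    assume le: "\<bar>peval F m\<bar> \<le> ?R"
    show "0 \<in> centered_form F (m, w)"
    \<comment> \<open>The preimage of 0 is found by dividing by \<open>?R\<close>, so the degenerate
      interval is treated first.\<close>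
    proof (cases "?R = 0")
      case True
      then show ?thesis using le by (auto simp: eq intro!: image_eqI[of _ _ 0])
    next
      case False
      then show ?thesis using le R unfolding eq
        by (intro image_eqI[of _ _ "- peval F m / ?R"]) (auto simp: field_simps abs_le_iff)
    qed
  qed
qed

text \<open>Grouped by degree, the coefficient bounds and the count of exponents give at most |F(m)|
  2^(N-1) ((1+y)^D - 1). By (1+y)^D \<le> exp(yD), the smallness of \<open>h\<close> makes the
  factor of |F(m)| less than 1.\<close>

lemma form_radius_less:
  fixes m :: "real ^ 'v::finite"
  defines "N \<equiv> real CARD('v)"
  assumes "0 < r" and nz: "\<And>z. dist (cvec m) z < r \<Longrightarrow> peval F z \<noteq> 0"
    and "0 \<le> h" and less: "h * (2 powr N * real (pdeg F)) < r * ln (1 + 2 powr (2 - 2 * N))"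
  shows "form_radius F m h < \<bar>peval F m\<bar>"
proof -
  define D where "D = pdeg F"
  \<comment> \<open>The leading 2 absorbs the factor \<open>2 ^ k\<close> from the number of
    exponents of degree \<open>k\<close>.\<close>
  define y where "y = 2 * (sqrt N * h / r)"
  let ?S = "{\<alpha> :: 'v \<Rightarrow>\<^sub>0 nat. 1 \<le> mdeg \<alpha> \<and> mdeg \<alpha> \<le> D}"
  have N1: "N \<ge> 1" unfolding N_def by (metis One_nat_def Suc_leI of_nat_1 of_nat_mono zero_less_card_finite)
  have y0: "0 \<le> y" using assms by (simp add: y_def)
  have Fm: "\<bar>peval F m\<bar> > 0" using nz[of "cvec m"] \<open>0 < r\<close> by (simp add: peval_cvec)
  have layer: "(\<Sum>\<alpha> | \<alpha> \<in> ?S \<and> mdeg \<alpha> = k. \<bar>taylor_coeff F m \<alpha>\<bar> * h ^ mdeg \<alpha>)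
      \<le> \<bar>peval F m\<bar> * 2 ^ (CARD('v) - 1) * (real (D choose k) * y ^ k)" if "k \<in> {1..D}" for k
  proof -
    have "{\<alpha>. \<alpha> \<in> ?S \<and> mdeg \<alpha> = k} = {\<alpha>. mdeg \<alpha> = k}" using that by auto
    moreover have "(\<Sum>\<alpha> | mdeg \<alpha> = k. \<bar>taylor_coeff F m \<alpha>\<bar> * h ^ mdeg \<alpha>)
      \<le> (\<Sum>\<alpha> :: 'v \<Rightarrow>\<^sub>0 nat | mdeg \<alpha> = k. \<bar>peval F m\<bar> * real (D choose k) * (sqrt N / r) ^ k * h ^ k)"
    proof (rule sum_mono)
      fix \<alpha> :: "'v \<Rightarrow>\<^sub>0 nat"
      assume "\<alpha> \<in> {\<alpha>. mdeg \<alpha> = k}"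
      then have a: "mdeg \<alpha> = k" "mdeg \<alpha> \<le> pdeg F" using that by (auto simp: D_def)
      then show "\<bar>taylor_coeff F m \<alpha>\<bar> * h ^ mdeg \<alpha>
          \<le> \<bar>peval F m\<bar> * real (D choose k) * (sqrt N / r) ^ k * h ^ k"
        using taylor_coeff_bound[OF \<open>0 < r\<close> nz a(2)] \<open>0 \<le> h\<close>
        by (auto simp: D_def N_def intro!: mult_right_mono)
    qed
    moreover have "\<dots> \<le> real (2 ^ (CARD('v) - 1) * 2 ^ k)
        * (\<bar>peval F m\<bar> * real (D choose k) * (sqrt N / r) ^ k * h ^ k)"
      unfolding sum_constant of_nat_mult[symmetric]
      using \<open>0 < r\<close> \<open>0 \<le> h\<close> N1
      by (intro mult_right_mono of_nat_mono card_mdeg_eq_le) auto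
    ultimately show ?thesis
      by (simp add: y_def power_mult_distrib power_divide mult_ac)
  qed
  have "form_radius F m h = (\<Sum>k\<in>{1..D}. \<Sum>\<alpha> | \<alpha> \<in> ?S \<and> mdeg \<alpha> = k. \<bar>taylor_coeff F m \<alpha>\<bar> * h ^ mdeg \<alpha>)"
    unfolding form_radius_def D_def[symmetric]
    by (rule sum.group[symmetric]) (auto simp: finite_mdeg_ge_1[simplified])
  also have "\<dots> \<le> (\<Sum>k\<in>{1..D}. \<bar>peval F m\<bar> * 2 ^ (CARD('v) - 1) * (real (D choose k) * y ^ k))"
    by (rule sum_mono) (rule layer)
  also have "\<dots> = \<bar>peval F m\<bar> * 2 ^ (CARD('v) - 1) * ((1 + y) ^ D - 1)"
  proof -
    have "(1 + y) ^ D = (\<Sum>k\<le>D. real (D choose k) * y ^ k)"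
      using binomial_ring[of y 1 D] by (simp add: add.commute)
    also have "\<dots> = 1 + (\<Sum>k\<in>{1..D}. real (D choose k) * y ^ k)"
      by (simp add: atMost_atLeast0 sum.atLeast_Suc_atMost)
    finally show ?thesis by (simp add: sum_distrib_left)
  qed
  also have "\<dots> < \<bar>peval F m\<bar>"
  proof -
    \<comment> \<open>This links the factor in \<open>y\<close> to the constant of the hypothesis.
      Halved and squared, it reads N \<le> 4^(N-1).\<close>
    have "2 * sqrt N \<le> 2 powr N"
    proof -
      have "N \<le> 4 ^ (CARD('v) - 1)"
      proof -
        have "CARD('v) - 1 < 2 ^ (CARD('v) - 1)" by (rule less_exp)
        also have "(2::nat) ^ (CARD('v) - 1) \<le> 4 ^ (CARD('v) - 1)" by (rule power_mono) auto
        finally have "CARD('v) \<le> 4 ^ (CARD('v) - 1)" by linarith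
        then show ?thesis unfolding N_def by (metis of_nat_le_iff of_nat_numeral of_nat_power)
      qed
      also have "(4::real) ^ (CARD('v) - 1) = (2 ^ (CARD('v) - 1))\<^sup>2"
        by (simp add: power2_eq_square flip: power_mult_distrib)
      finally have "sqrt N \<le> 2 ^ (CARD('v) - 1)" by (simp add: real_le_lsqrt)
      then have "2 * sqrt N \<le> 2 * 2 ^ (CARD('v) - 1)" by simp
      also have "\<dots> = (2::real) ^ CARD('v)" by (simp flip: power_Suc)
      finally show ?thesis by (simp add: N_def powr_realpow)
    qed
    then have "h * (2 * sqrt N * real D) \<le> h * (2 powr N * real D)"
      using \<open>0 \<le> h\<close> by (intro mult_left_mono mult_right_mono) auto
    then have "y * real D < ln (1 + 2 powr (2 - 2 * N))"
      using less \<open>0 < r\<close> by (simp add: y_def D_def field_simps)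
    \<comment> \<open>Here 2 - 2N \<le> 1 - N because N \<ge> 1. The term 2^(1-N) is what cancels
      the factor 2^(N-1).\<close>
    also have "\<dots> \<le> ln (1 + 2 powr (1 - N))"
      using N1 by (subst ln_le_cancel_iff) (auto intro!: add_pos_pos powr_mono)
    finally have "exp (y * real D) < exp (ln (1 + 2 powr (1 - N)))" by simp
    also have "\<dots> = 1 + 2 powr (1 - N)" by (simp add: add_pos_pos)
    finally have "exp (y * real D) < 1 + 2 powr (1 - N)" .
    moreover have "(1 + y) ^ D \<le> exp (y * real D)"
      using power_mono[OF exp_ge_add_one_self[of y], of D] y0
      by (simp add: exp_of_nat2_mult)
    ultimately have "(1 + y) ^ D - 1 < 2 powr (1 - N)" by linarith
    then have "2 ^ (CARD('v) - 1) * ((1 + y) ^ D - 1) < 2 ^ (CARD('v) - 1) * 2 powr (1 - N)"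
      by (intro mult_strict_left_mono) auto
    also have "\<dots> = 1"
    proof -
      have "(2::real) ^ (CARD('v) - 1) = 2 powr (N - 1)"
        using N1 by (subst powr_realpow[symmetric]) (auto simp: N_def of_nat_diff)
      then show ?thesis by (simp flip: powr_add)
    qed
    finally show ?thesis using Fm by (simp add: mult.assoc)
  qed
  finally show ?thesis .
qed

section \<open>Distance to the complex zero set\<close>

lemma dist_C_cvec: "dist_C p F = (INF z \<in> {z. peval F z = 0}. ennreal (dist (cvec p) z))"
  by (simp add: dist_C_def cvec_def)

lemma dist_le_half_diagonal:
  fixes m x :: "real ^ 'v::finite"
  assumes "x \<in> cube_set (m, w)"
  shows "dist x m \<le> sqrt CARD('v) * (w / 2)"
proof -
  have le: "\<bar>x $ i - m $ i\<bar> \<le> w / 2" for i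
  proof -
    have "m $ i - w / 2 \<le> x $ i" "x $ i \<le> m $ i + w / 2"
      using assms by (auto simp: cube_set_def)
    then show ?thesis by linarith
  qed
  then have w: "0 \<le> w / 2" by (meson abs_ge_zero order_trans)
  have "dist x m = L2_set (\<lambda>i. \<bar>x $ i - m $ i\<bar>) UNIV"
    by (simp add: dist_norm norm_vec_def L2_set_def)
  also have "\<dots> \<le> L2_set (\<lambda>i :: 'v. w / 2) UNIV"
    using le by (intro L2_set_mono) auto
  also have "\<dots> = sqrt CARD('v) * (w / 2)"
    using w by (simp add: L2_set_def real_sqrt_mult)
  finally show ?thesis .
qed

text \<open>Contrapositively, a larger distance from \<open>x\<close> leaves a zero-free ball about
  \<open>m\<close>, smaller by at most half the diagonal, to which \<open>form_radius_less\<close>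
  applies. The summand \<open>sqrt N * L\<close> pays for the half diagonal. \<open>D\<close> is an
  upper bound for the degree, so that an estimate of the degree of g can be inserted.\<close>

lemma dist_C_le_if_zero_in_centered_form:
  fixes m x :: "real ^ 'v::finite"
  defines "N \<equiv> real CARD('v)"
  defines "L \<equiv> ln (1 + 2 powr (2 - 2 * N))"
  assumes zero: "0 \<in> centered_form F (m, w)" and w: "0 < w"
    and x: "x \<in> cube_set (m, w)" and D: "real (pdeg F) \<le> D"
  shows "dist_C x F \<le> ennreal (w * (2 powr N * D + sqrt N * L) / (2 * L))"
proof (rule ccontr)
  let ?a = "w * (2 powr N * D + sqrt N * L) / (2 * L)"
  have L: "0 < L" unfolding L_def by (rule ln_gt_zero) simp
  have a0: "0 \<le> ?a" using L w D by (simp add: N_def)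
  assume "\<not> dist_C x F \<le> ennreal ?a"
  \<comment> \<open>A finite radius strictly in between also covers an infinite distance and
    supplies the strict inequality.\<close>
  then obtain c where c: "ennreal ?a < c" "c < dist_C x F" by (meson dense not_le)
  then obtain r0 where r0: "c = ennreal r0" "0 \<le> r0" by (cases c) auto
  define r where "r = r0 - sqrt N * (w / 2)"
  have "?a < r0" using c(1) a0 by (simp add: r0 ennreal_less_iff)
  then have "w / 2 * (2 powr N * D) / L < r"
    using L by (simp add: r_def field_simps)
  then have rL: "w / 2 * (2 powr N * D) < r * L"
    using L by (simp add: field_simps)
  have "0 \<le> w / 2 * (2 powr N * D)" using w D by simp
  with rL L have "0 < r" by (smt (verit) mult_nonpos_nonneg)
  have "w / 2 * (2 powr N * real (pdeg F)) \<le> w / 2 * (2 powr N * D)"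
    using w D by (intro mult_left_mono) auto
  with rL have less: "w / 2 * (2 powr N * real (pdeg F)) < r * L" by linarith
  have "peval F z \<noteq> 0" if "dist (cvec m) z < r" for z
  proof
    assume "peval F z = 0"
    then have "dist_C x F \<le> ennreal (dist (cvec x) z)"
      unfolding dist_C_cvec by (intro INF_lower) simp
    also have "dist (cvec x) z \<le> dist (cvec x) (cvec m) + dist (cvec m) z" by (rule dist_triangle)
    also have "\<dots> \<le> r0"
      using dist_le_half_diagonal[OF x] that by (simp add: dist_cvec r_def N_def)
    finally show False using c(2) r0 by (simp add: leD ennreal_leI)
  qed
  from form_radius_less[OF \<open>0 < r\<close> this _ less[unfolded N_def L_def]]
  have "form_radius F m (w / 2) < \<bar>peval F m\<bar>" using w by simp
  with zero w show False by (simp add: zero_in_centered_form_iff)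
qed

text \<open>The centered form encloses the values of \<open>F\<close> on the cube: in the Taylor
  expansion at \<open>m\<close>, the terms of positive order sum to at most
  \<open>form_radius\<close> in modulus.\<close>

lemma peval_nonzero_on_cube:
  fixes m x :: "real ^ 'v::finite"
  assumes "0 \<notin> centered_form F (m, w)" "0 \<le> w" "x \<in> cube_set (m, w)"
  shows "peval F x \<noteq> 0"
proof -
  let ?S = "{\<alpha> :: 'v \<Rightarrow>\<^sub>0 nat. 1 \<le> mdeg \<alpha> \<and> mdeg \<alpha> \<le> pdeg F}"
  define u where "u = x - m"
  have u: "\<bar>u $ i\<bar> \<le> w / 2" for i
  proof -
    have "m $ i - w / 2 \<le> x $ i" "x $ i \<le> m $ i + w / 2"
      using assms(3) by (auto simp: cube_set_def)
    then show ?thesis unfolding u_def vector_minus_component by linarith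
  qed
  have "{\<alpha> :: 'v \<Rightarrow>\<^sub>0 nat. mdeg \<alpha> \<le> pdeg F} = insert 0 ?S"
    by (auto simp: Suc_le_eq mdeg_eq_0_iff simp flip: neq0_conv) (simp add: mdeg_def)
  moreover have "0 \<notin> ?S" by (simp add: mdeg_def)
  moreover have "taylor_coeff F m 0 * mmono 0 u = peval F m"
    by (simp add: taylor_coeff_def mfact_def mmono_def)
  ultimately have "peval F (m + u) = peval F m + (\<Sum>\<alpha>\<in>?S. taylor_coeff F m \<alpha> * mmono \<alpha> u)"
    unfolding peval_taylor by (simp add: finite_mdeg_ge_1[simplified])
  moreover have "\<bar>\<Sum>\<alpha>\<in>?S. taylor_coeff F m \<alpha> * mmono \<alpha> u\<bar> \<le> form_radius F m (w / 2)"
    unfolding form_radius_def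
  proof (rule order_trans[OF sum_abs], rule sum_mono)
    fix \<alpha> :: "'v \<Rightarrow>\<^sub>0 nat"
    have "\<bar>mmono \<alpha> u\<bar> \<le> (\<Prod>i\<in>UNIV. (w / 2) ^ Poly_Mapping.lookup \<alpha> i)"
      unfolding mmono_def abs_prod power_abs using u by (intro prod_mono) (auto intro!: power_mono)
    also have "\<dots> = (w / 2) ^ mdeg \<alpha>" by (simp add: mdeg_def power_sum)
    finally show "\<bar>taylor_coeff F m \<alpha> * mmono \<alpha> u\<bar> \<le> \<bar>taylor_coeff F m \<alpha>\<bar> * (w / 2) ^ mdeg \<alpha>"
      by (simp add: abs_mult mult_left_mono)
  qed
  moreover have "form_radius F m (w / 2) < \<bar>peval F m\<bar>"
    using assms by (simp add: zero_in_centered_form_iff not_le)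
  ultimately show ?thesis by (auto simp: u_def)
qed

lemma cube_set_cbox: "cube_set (m, w) = cbox (\<chi> i. m $ i - w / 2) (\<chi> i. m $ i + w / 2)"
  by (auto simp: cube_set_def mem_box_cart)

text \<open>The embedded cube is compact, the complex zero set is closed, and they are disjoint
  because a zero at a real point would be a zero in the cube.\<close>

lemma dist_C_bounded_below_on_cube:
  fixes m :: "real ^ 'v::finite"
  assumes "0 \<notin> centered_form F (m, w)" "0 \<le> w"
  shows "\<exists>\<delta>>0. \<forall>x\<in>cube_set (m, w). ennreal \<delta> \<le> dist_C x F"
proof -
  have "compact (cvec ` cube_set (m, w))"
    unfolding cube_set_cbox cvec_def
    by (intro compact_continuous_image continuous_intros compact_cbox)
  moreover have "closed {z :: complex ^ 'v. peval F z = 0}"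
    unfolding peval_def by (intro closed_Collect_eq continuous_intros)
  moreover have "cvec ` cube_set (m, w) \<inter> {z. peval F z = 0} = {}"
    using peval_nonzero_on_cube[OF assms] by (auto simp: peval_cvec)
  ultimately obtain \<delta> where "\<delta> > 0"
    "\<forall>x\<in>cvec ` cube_set (m, w). \<forall>z\<in>{z. peval F z = 0}. \<delta> \<le> dist x z"
    using separate_compact_closed by metis
  then show ?thesis
    by (auto simp: dist_C_cvec intro!: exI[of _ \<delta>] INF_greatest ennreal_leI)
qed

section \<open>The degree of the gradient product\<close>

lemma mdeg_add: "mdeg (\<mu> + \<nu>) = mdeg \<mu> + mdeg \<nu>"
  by (simp add: mdeg_def lookup_add sum.distrib)

lemma pdeg_sum_le: "(\<And>a. a \<in> A \<Longrightarrow> pdeg (G a) \<le> k) \<Longrightarrow> pdeg (sum G A) \<le> k"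
  by (rule pdeg_leI) (use keys_sum[of G A] mdeg_le_pdeg order_trans in blast)

lemma pdeg_mult_le: "pdeg (F * G) \<le> pdeg F + pdeg G"
  by (rule pdeg_leI) (use keys_mult[of F G] in \<open>force simp: mdeg_add intro!: add_mono mdeg_le_pdeg\<close>)

lemma pdeg_single_le: "(c \<noteq> 0 \<Longrightarrow> mdeg \<mu> \<le> k) \<Longrightarrow> pdeg (Poly_Mapping.single \<mu> c) \<le> k"
  by (rule pdeg_leI) (auto split: if_splits)

text \<open>Monomials keep their total degree even if \<open>h\<close> merges variables; terms may
  cancel then, so only an inequality holds.\<close>

lemma pdeg_rename_le: "pdeg (rename h F) \<le> pdeg F"
  for h :: "'v::finite \<Rightarrow> 'w::finite"
  unfolding rename_def
proof (intro pdeg_sum_le pdeg_single_le)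
  fix \<mu> :: "'v \<Rightarrow>\<^sub>0 nat"
  assume \<mu>: "\<mu> \<in> Poly_Mapping.keys F"
  have "mdeg (\<Sum>i\<in>UNIV. Poly_Mapping.single (h i) (Poly_Mapping.lookup \<mu> i))
      = (\<Sum>k\<in>UNIV. \<Sum>i | i \<in> UNIV \<and> h i = k. Poly_Mapping.lookup \<mu> i)"
    by (simp add: mdeg_def lookup_sum_single)
  also have "\<dots> = mdeg \<mu>"
    unfolding mdeg_def by (rule sum.group) auto
  finally show "mdeg (\<Sum>i\<in>UNIV. Poly_Mapping.single (h i) (Poly_Mapping.lookup \<mu> i)) \<le> pdeg F"
    using mdeg_le_pdeg[OF \<mu>] by simp
qed

text \<open>A nonzero coefficient in the derivative forces \<mu>_i \<ge> 1, so the truncated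
  subtraction removes exactly one degree.\<close>

lemma pdeg_partial_le: "pdeg (partial i F) \<le> pdeg F - 1"
  unfolding pdiff_def
proof (intro pdeg_sum_le pdeg_single_le)
  fix \<mu>
  let ?e = "Poly_Mapping.single i (1::nat)"
  assume \<mu>: "\<mu> \<in> Poly_Mapping.keys F"
    and nz: "real (\<Prod>j\<in>UNIV. fact (Poly_Mapping.lookup ?e j) *
      (Poly_Mapping.lookup \<mu> j choose Poly_Mapping.lookup ?e j)) * Poly_Mapping.lookup F \<mu> \<noteq> 0"
  then have "\<forall>j. Poly_Mapping.lookup ?e j \<le> Poly_Mapping.lookup \<mu> j" by (auto simp: not_less)
  then have "Poly_Mapping.lookup ?e i \<le> Poly_Mapping.lookup \<mu> i" ..
  then have "0 < Poly_Mapping.lookup \<mu> i" by (simp add: lookup_single)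
  then have "\<mu> = (\<mu> - ?e) + ?e"
    by (intro poly_mapping_eqI) (auto simp: lookup_add lookup_minus lookup_single when_def)
  then have "mdeg \<mu> = mdeg (\<mu> - ?e) + mdeg ?e" by (metis mdeg_add)
  moreover have "mdeg ?e = 1" by (simp add: mdeg_def lookup_single when_def)
  ultimately show "mdeg (\<mu> - ?e) \<le> pdeg F - 1" using mdeg_le_pdeg[OF \<mu>] by linarith
qed

text \<open>The source of the second numerator: in dimension 2n this degree bound gives 2^(2n) 2
  (d-1) = 2^(2n+1) (d-1).\<close>

lemma pdeg_grad_prod_le: "pdeg (grad_prod f) \<le> 2 * (pdeg f - 1)"
  unfolding grad_prod_def
proof (rule pdeg_sum_le)
  fix i
  have "pdeg (partial i f) + pdeg (partial i f) \<le> 2 * (pdeg f - 1)"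
    using pdeg_partial_le[of i f] by linarith
  then show "pdeg (rename Inl (partial i f) * rename Inr (partial i f)) \<le> 2 * (pdeg f - 1)"
    by (intro order_trans[OF pdeg_mult_le] order_trans[OF add_mono[OF pdeg_rename_le pdeg_rename_le]])
qed

lemma pdeg_pos_if_nonconstant:
  assumes "\<not> is_constant f"
  shows "1 \<le> pdeg f"
proof (rule ccontr)
  assume "\<not> 1 \<le> pdeg f"
  then have "\<mu> = 0" if "\<mu> \<in> Poly_Mapping.keys f" for \<mu>
    using mdeg_le_pdeg[OF that] by (simp add: mdeg_eq_0_iff[symmetric])
  then have "f = Poly_Mapping.single 0 (Poly_Mapping.lookup f 0)"
    by (intro poly_mapping_eqI) (auto simp: lookup_single when_def in_keys_iff)
  with assms show False by (auto simp: is_constant_def)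
qed

section \<open>Invariants of the subdivision\<close>

text \<open>Neighbouring cubes share faces, so disjointness is expressed with open cubes, which have
  the same volume.\<close>

definition cube_interior :: "'n::finite cube \<Rightarrow> (real ^ 'n) set" where
  "cube_interior Q = (case Q of (m, w) \<Rightarrow> {x. \<forall>i. m $ i - w / 2 < x $ i \<and> x $ i < m $ i + w / 2})"

lemma cube_interior_subset: "cube_interior Q \<subseteq> cube_set Q"
  by (auto simp: cube_interior_def cube_set_def intro: less_imp_le)

lemma cube_interior_nonempty: "0 < snd Q \<Longrightarrow> fst Q \<in> cube_interior Q"
  by (cases Q) (simp add: cube_interior_def)

lemma cube_interior_box:
  "cube_interior (m, w) = box (\<chi> i. m $ i - w / 2) (\<chi> i. m $ i + w / 2)"
  by (auto simp: cube_interior_def mem_box_cart)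

lemma emeasure_cube_interior:
  fixes Q :: "'n::finite cube"
  assumes "0 \<le> snd Q"
  shows "emeasure lborel (cube_interior Q) = ennreal (snd Q) ^ CARD('n)"
proof -
  obtain m w where Q: "Q = (m, w)" by (cases Q)
  have eq: "(\<chi> i. m $ i + w / 2) - (\<chi> i. m $ i - w / 2) = (\<chi> i. w)"
    by (simp add: vec_eq_iff)
  have inner: "(\<chi> i. w) \<bullet> b = w" if "b \<in> Basis" for b :: "real ^ 'n"
    using that by (auto simp: Basis_vec_def inner_axis)
  have "emeasure lborel (cube_interior Q)
      = (\<Prod>b\<in>Basis. ((\<chi> i. m $ i + w / 2) - (\<chi> i. m $ i - w / 2)) \<bullet> (b :: real ^ 'n))"
    unfolding Q cube_interior_box
  proof (rule emeasure_lborel_box)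
    fix b :: "real ^ 'n"
    assume "b \<in> Basis"
    then have "((\<chi> i. m $ i + w / 2) - (\<chi> i. m $ i - w / 2)) \<bullet> b = w" by (simp only: eq inner)
    then show "(\<chi> i. m $ i - w / 2) \<bullet> b \<le> (\<chi> i. m $ i + w / 2) \<bullet> b"
      using assms by (simp add: Q inner_diff_left)
  qed
  also have "\<dots> = ennreal w ^ CARD('n)"
    unfolding eq using assms by (simp add: inner Q ennreal_power)
  finally show ?thesis by (simp add: Q)
qed

lemma subcubes_cover:
  fixes Q :: "'n::finite cube"
  shows "cube_set Q \<subseteq> (\<Union>J\<in>subcubes Q. cube_set J)"
proof
  fix x assume x: "x \<in> cube_set Q"
  obtain m w where Q: "Q = (m, w)" by (cases Q)
  \<comment> \<open>In each coordinate the sign selects a half of the side containing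
    \<open>x\<close>; a tie goes to the upper half.\<close>
  define e :: "real ^ 'n" where "e = (\<chi> i. if m $ i \<le> x $ i then 1 else - 1)"
  have "(m + (w / 4) *\<^sub>R e, w / 2) \<in> subcubes Q"
    unfolding subcubes_def Q prod.case by (intro CollectI exI[of _ e]) (simp add: e_def)
  moreover have "m $ i + w / 4 * e $ i - w / 2 / 2 \<le> x $ i \<and> x $ i \<le> m $ i + w / 4 * e $ i + w / 2 / 2" for i
  proof -
    have "m $ i - w / 2 \<le> x $ i" "x $ i \<le> m $ i + w / 2"
      using x by (auto simp: cube_set_def Q)
    then show ?thesis by (auto simp: e_def)
  qed
  then have "x \<in> cube_set (m + (w / 4) *\<^sub>R e, w / 2)"
    by (simp add: cube_set_def)
  ultimately show "x \<in> (\<Union>J\<in>subcubes Q. cube_set J)" by blast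
qed

lemma snd_subcubes: "J \<in> subcubes Q \<Longrightarrow> snd J = snd Q / 2"
  by (auto simp: subcubes_def split: prod.splits)

lemma subcubes_coord:
  assumes "J \<in> subcubes (m, w)"
  shows "fst J $ i = m $ i - w / 4 \<or> fst J $ i = m $ i + w / 4"
proof -
  obtain e where e: "J = (m + (w / 4) *\<^sub>R e, w / 2)" "\<forall>i. e $ i = - 1 \<or> e $ i = 1"
    using assms unfolding subcubes_def by blast
  from e(2)[rule_format, of i] show ?thesis by (auto simp: e(1))
qed

lemma subcubes_subset:
  assumes "J \<in> subcubes Q" "0 < snd Q"
  shows "cube_set J \<subseteq> cube_set Q" "cube_interior J \<subseteq> cube_interior Q"
proof -
  obtain m w where Q: "Q = (m, w)" by (cases Q)
  obtain m' where J: "J = (m', w / 2)" using snd_subcubes[OF assms(1)] by (cases J) (simp add: Q)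
  have c: "m' $ i = m $ i - w / 4 \<or> m' $ i = m $ i + w / 4" for i
    using subcubes_coord[OF assms(1)[unfolded Q], of i] by (simp add: J)
  have b: "m $ i - w / 2 \<le> m' $ i - w / 4 \<and> m' $ i + w / 4 \<le> m $ i + w / 2" for i
    using c[of i] assms(2) by (auto simp: Q)
  show "cube_set J \<subseteq> cube_set Q"
  proof
    fix x assume "x \<in> cube_set J"
    then have x: "m' $ i - w / 2 / 2 \<le> x $ i \<and> x $ i \<le> m' $ i + w / 2 / 2" for i
      by (simp add: cube_set_def J)
    have "m $ i - w / 2 \<le> x $ i \<and> x $ i \<le> m $ i + w / 2" for i
      using x[of i] b[of i] by linarith
    then show "x \<in> cube_set Q" by (simp add: cube_set_def Q)
  qed
  show "cube_interior J \<subseteq> cube_interior Q"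
  proof
    fix x assume "x \<in> cube_interior J"
    then have x: "m' $ i - w / 2 / 2 < x $ i \<and> x $ i < m' $ i + w / 2 / 2" for i
      by (simp add: cube_interior_def J)
    have "m $ i - w / 2 < x $ i \<and> x $ i < m $ i + w / 2" for i
      using x[of i] b[of i] by linarith
    then show "x \<in> cube_interior Q" by (simp add: cube_interior_def Q)
  qed
qed

text \<open>Distinct children have equal width, so their midpoints differ in some coordinate. There
  they lie in opposite open halves of the side.\<close>

lemma subcubes_disjoint:
  assumes "J \<in> subcubes Q" "J' \<in> subcubes Q" "J \<noteq> J'" "0 < snd Q"
  shows "cube_interior J \<inter> cube_interior J' = {}"
proof -
  obtain m w where Q: "Q = (m, w)" by (cases Q)
  have snd: "snd J = w / 2" "snd J' = w / 2" 
    using assms(1,2)[THEN snd_subcubes] by (auto simp: Q)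
  then obtain i where i: "fst J $ i \<noteq> fst J' $ i"
    using assms(3) by (metis prod.expand vec_eq_iff)
  have cases: "fst J $ i = m $ i - w / 4 \<and> fst J' $ i = m $ i + w / 4 \<or>
      fst J $ i = m $ i + w / 4 \<and> fst J' $ i = m $ i - w / 4"
    using i subcubes_coord[OF assms(1)[unfolded Q], of i]
      subcubes_coord[OF assms(2)[unfolded Q], of i] by auto
  have bounds: "fst J $ i - w / 4 < x $ i \<and> x $ i < fst J $ i + w / 4"
    "fst J' $ i - w / 4 < x $ i \<and> x $ i < fst J' $ i + w / 4"
    if "x \<in> cube_interior J" "x \<in> cube_interior J'" for x
    using that snd by (auto simp: cube_interior_def split: prod.splits)
  show ?thesis
  proof (rule equals0I)
    fix x assume "x \<in> cube_interior J \<inter> cube_interior J'"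
    with bounds[of x] cases show False by auto
  qed
qed

text \<open>Two opposite corners suffice to make every subdivision enlarge the partition.\<close>

lemma card_subcubes_ge_2:
  assumes "0 < snd Q"
  shows "2 \<le> card (subcubes Q)"
proof -
  obtain m w where Q: "Q = (m, w)" by (cases Q)
  let ?J = "\<lambda>t. (m + (w / 4) *\<^sub>R vec t, w / 2)"
  have "fst (?J 1) $ i \<noteq> fst (?J (- 1)) $ i" for i using assms by (simp add: Q)
  then have "?J 1 \<noteq> ?J (- 1)" by metis
  then have "card {?J 1, ?J (- 1)} = 2" by simp
  moreover have "{?J 1, ?J (- 1)} \<subseteq> subcubes Q"
    unfolding subcubes_def Q prod.case by (auto intro: exI[of _ "vec _"])
  ultimately show ?thesis by (metis card_mono finite_subcubes)
qed

text \<open>The last clause is what the counting rests on: each cube lies in a cube of twice its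
  width on which both tests fail. Only the initial partition is exempt, which explains the 1 in the
  maximum.\<close>

definition PV_invariant :: "'n::finite rpoly \<Rightarrow> 'n cube \<Rightarrow> 'n cube set \<Rightarrow> bool" where
  "PV_invariant f I P \<longleftrightarrow> finite P \<and> cube_set I \<subseteq> (\<Union>J\<in>P. cube_set J) \<and>
     (\<forall>J\<in>P. 0 < snd J \<and> cube_set J \<subseteq> cube_set I) \<and>
     (\<forall>J\<in>P. \<forall>J'\<in>P. J \<noteq> J' \<longrightarrow> cube_interior J \<inter> cube_interior J' = {}) \<and>
     (P = {I} \<or> (\<forall>J\<in>P. \<exists>Q. snd Q = 2 * snd J \<and> cube_set J \<subseteq> cube_set Q \<and> \<not> C0 f Q \<and> \<not> C1 f Q))"

text \<open>The new cubes have the subdivided cube as failing parent, and the others keep theirs.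
  One cube is replaced by at least two that were not present before.\<close>

lemma PV_invariant_step:
  assumes inv: "PV_invariant f I P" and step: "subdiv_step f P P'"
  shows "PV_invariant f I P'" "card P < card P'"
proof -
  obtain Q where Q: "Q \<in> P" "\<not> C0 f Q" "\<not> C1 f Q" and P': "P' = (P - {Q}) \<union> subcubes Q"
    using step by (auto simp: subdiv_step_def)
  have fin: "finite P"
    using inv unfolding PV_invariant_def by (elim conjE)
  have cover: "cube_set I \<subseteq> (\<Union>J\<in>P. cube_set J)"
    using inv unfolding PV_invariant_def by (elim conjE)
  have "\<forall>J\<in>P. 0 < snd J \<and> cube_set J \<subseteq> cube_set I"
    using inv unfolding PV_invariant_def by (elim conjE)
  then have cubes: "0 < snd J \<and> cube_set J \<subseteq> cube_set I" if "J \<in> P" for J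
    using that by (rule bspec)
  have "\<forall>J\<in>P. \<forall>J'\<in>P. J \<noteq> J' \<longrightarrow> cube_interior J \<inter> cube_interior J' = {}"
    using inv unfolding PV_invariant_def by (elim conjE)
  then have disj: "cube_interior J \<inter> cube_interior J' = {}" if "J \<in> P" "J' \<in> P" "J \<noteq> J'" for J J'
    using that by (elim ballE[of _ _ J] ballE[of _ _ J']) auto
  have parent: "P = {I} \<or> (\<forall>J\<in>P. \<exists>Q. snd Q = 2 * snd J \<and> cube_set J \<subseteq> cube_set Q \<and> \<not> C0 f Q \<and> \<not> C1 f Q)"
    using inv unfolding PV_invariant_def by (elim conjE)
  have Qpos: "0 < snd Q" using cubes[OF Q(1)] by blast
  have sub: "0 < snd J" "snd Q = 2 * snd J" "cube_set J \<subseteq> cube_set Q" "cube_interior J \<subseteq> cube_interior Q"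
    if "J \<in> subcubes Q" for J
    using snd_subcubes[OF that] subcubes_subset[OF that Qpos] Qpos by auto
  have old_new: "cube_interior J \<inter> cube_interior J' = {}"
    if "J \<in> P - {Q}" "J' \<in> subcubes Q" for J J'
    using disj[of J Q] sub(4)[OF that(2)] that(1) Q(1) by auto
  show "PV_invariant f I P'"
    unfolding PV_invariant_def
  proof (intro conjI ballI impI)
    show "finite P'" by (simp add: P' fin finite_subcubes)
    show "cube_set I \<subseteq> (\<Union>J\<in>P'. cube_set J)"
    proof
      fix x assume "x \<in> cube_set I"
      then obtain J where J: "J \<in> P" "x \<in> cube_set J" using cover by blast
      then show "x \<in> (\<Union>J\<in>P'. cube_set J)"
        using subcubes_cover[of Q] by (cases "J = Q") (auto simp: P')
    qed
    have old_or_new: "J \<in> P - {Q} \<or> J \<in> subcubes Q" if "J \<in> P'" for J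
      using that by (simp only: P' Un_iff)
    show "0 < snd J" if "J \<in> P'" for J
      using old_or_new[OF that] cubes[of J] sub(1)[of J] by blast
    show "cube_set J \<subseteq> cube_set I" if "J \<in> P'" for J
      using old_or_new[OF that] cubes[of J] sub(3)[of J] cubes[OF Q(1)] by blast
    show "cube_interior J \<inter> cube_interior J' = {}" if "J \<in> P'" "J' \<in> P'" "J \<noteq> J'" for J J'
      using old_or_new[OF that(1)] old_or_new[OF that(2)]
    proof (elim disjE)
      assume "J \<in> P - {Q}" "J' \<in> P - {Q}"
      then show ?thesis using disj \<open>J \<noteq> J'\<close> by blast
    next
      assume "J \<in> subcubes Q" "J' \<in> P - {Q}"
      then show ?thesis using old_new[of J' J] by (simp only: Int_commute)
    next
      assume "J \<in> subcubes Q" "J' \<in> subcubes Q"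
      then show ?thesis using subcubes_disjoint \<open>J \<noteq> J'\<close> Qpos by blast
    qed (rule old_new)
    have "\<exists>Q. snd Q = 2 * snd J \<and> cube_set J \<subseteq> cube_set Q \<and> \<not> C0 f Q \<and> \<not> C1 f Q" if "J \<in> P'" for J
    proof (cases "J \<in> subcubes Q")
      case True
      show ?thesis by (intro exI[of _ Q] conjI sub[OF True] Q)
    next
      case False
      then have J: "J \<in> P" "J \<noteq> Q" using old_or_new[OF that] by auto
      \<comment> \<open>\<open>P\<close> contains the two cubes \<open>J\<close> and
        \<open>Q\<close>, so the exemption does not apply and \<open>J\<close> already has a failing
        parent.\<close>
      then have "P \<noteq> {I}" using Q(1) by auto
      with parent J(1) show ?thesis by blast
    qed
    then show "P' = {I} \<or> (\<forall>J\<in>P'. \<exists>Q. snd Q = 2 * snd J \<and> cube_set J \<subseteq> cube_set Q \<and> \<not> C0 f Q \<and> \<not> C1 f Q)"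
      by blast
  qed
  \<comment> \<open>A child already present would have an interior disjoint from itself, although
    this interior contains its midpoint.\<close>
  have "(P - {Q}) \<inter> subcubes Q = {}"
  proof (rule equals0I)
    fix J assume J: "J \<in> (P - {Q}) \<inter> subcubes Q"
    then have "cube_interior J \<inter> cube_interior J = {}" by (intro old_new) auto
    moreover have "fst J \<in> cube_interior J" using J sub(1) by (intro cube_interior_nonempty) auto
    ultimately show False by blast
  qed
  then have "card P' = card (P - {Q}) + card (subcubes Q)"
    unfolding P' by (intro card_Un_disjoint) (auto simp: fin finite_subcubes)
  moreover have "card P = Suc (card (P - {Q}))"
    using fin Q(1) by (rule card.remove)
  ultimately show "card P < card P'" using card_subcubes_ge_2[OF Qpos] by linarith
qed

lemma PV_run_invariant:
  assumes run: "PV_run f I s" and "0 < snd I"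
  shows "PV_invariant f I (s k)"
proof (induction k)
  case 0
  then show ?case using assms by (simp add: PV_run_def PV_invariant_def)
next
  case (Suc k)
  have "if terminal f (s k) then s (Suc k) = s k else subdiv_step f (s k) (s (Suc k))"
    using run by (simp add: PV_run_def)
  with Suc show ?case using PV_invariant_step(1)[OF Suc] by (cases "terminal f (s k)") simp_all
qed

text \<open>Each step of such a run is a genuine subdivision, so the partitions grow without
  bound.\<close>

lemma PV_run_card_gt:
  assumes run: "PV_run f I s" and "0 < snd I" and "\<not> PV_terminates f s"
  shows "k < card (s k)"
proof (induction k)
  case 0
  then show ?case using run by (simp add: PV_run_def)
next
  case (Suc k)
  have "subdiv_step f (s k) (s (Suc k))"
    using run assms(3) by (simp add: PV_run_def PV_terminates_def)
  from PV_invariant_step(2)[OF PV_run_invariant[OF assms(1,2)] this] Suc show ?case by linarith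
qed

section \<open>Amortization\<close>

lemma ennreal_double_mult: "0 \<le> a \<Longrightarrow> 0 \<le> b \<Longrightarrow> 2 * (ennreal a * ennreal b) = ennreal (2 * (a * b))"
  by (simp add: ennreal_mult)

text \<open>A cube of width w contributes at least w^n (1/(2w))^n = 2^(-n) to the integral. The
  comparison passes through a step function on the disjoint interiors.\<close>

lemma card_cubes_le_integral:
  fixes G :: "real ^ 'n::finite \<Rightarrow> ennreal"
  assumes "finite P"
    and disj: "\<And>J J'. J \<in> P \<Longrightarrow> J' \<in> P \<Longrightarrow> J \<noteq> J' \<Longrightarrow> cube_interior J \<inter> cube_interior J' = {}"
    and cubes: "\<And>J. J \<in> P \<Longrightarrow> 0 < snd J \<and> cube_set J \<subseteq> A"
    and lower: "\<And>J x. J \<in> P \<Longrightarrow> x \<in> cube_set J \<Longrightarrow> ennreal (1 / (2 * snd J)) ^ CARD('n) \<le> G x"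
  shows "of_nat (card P) \<le> 2 ^ CARD('n) * (\<integral>\<^sup>+x\<in>A. G x \<partial>lborel)"
proof -
  let ?c = "\<lambda>J. ennreal (1 / (2 * snd J)) ^ CARD('n)"
  have meas [measurable]: "cube_interior J \<in> sets borel" for J :: "'n cube"
    by (cases J) (simp add: cube_interior_box)
  have one: "2 ^ CARD('n) * (?c J * emeasure lborel (cube_interior J)) = 1" if "J \<in> P" for J
  proof -
    have w: "0 < snd J" using cubes[OF that] by blast
    have "2 ^ CARD('n) * (?c J * emeasure lborel (cube_interior J))
        = (2 * (ennreal (1 / (2 * snd J)) * ennreal (snd J))) ^ CARD('n)"
      using w by (simp add: emeasure_cube_interior power_mult_distrib)
    also have "2 * (ennreal (1 / (2 * snd J)) * ennreal (snd J)) = ennreal (2 * (1 / (2 * snd J) * snd J))"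
      using w by (intro ennreal_double_mult) auto
    also have "2 * (1 / (2 * snd J) * snd J) = 1" using w by simp
    finally show ?thesis by simp
  qed
  have "(\<Sum>J\<in>P. ?c J * indicator (cube_interior J) x) \<le> G x * indicator A x" for x
  proof (cases "\<exists>J\<in>P. x \<in> cube_interior J")
    case True
    then obtain J where J: "J \<in> P" "x \<in> cube_interior J" by blast
    have "(\<Sum>J'\<in>P. ?c J' * indicator (cube_interior J') x)
        = (\<Sum>J'\<in>P. if J' = J then ?c J else 0)"
    proof (intro sum.cong refl)
      fix J' assume "J' \<in> P"
      then show "?c J' * indicator (cube_interior J') x = (if J' = J then ?c J else 0)"
      proof (cases "J' = J")
        case False
        then have "x \<notin> cube_interior J'" using disj[of J J'] J \<open>J' \<in> P\<close> by blast
        then show ?thesis using False by simp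
      qed (simp add: J(2))
    qed
    also have "\<dots> = ?c J" using assms(1) J(1) by simp
    also have "\<dots> \<le> G x"
      using lower[OF J(1)] J(2) cube_interior_subset[of J] by blast
    also have "\<dots> = G x * indicator A x"
    proof -
      have "x \<in> A" using cubes[OF J(1)] J(2) cube_interior_subset[of J] by blast
      then show ?thesis by simp
    qed
    finally show ?thesis .
  next
    case False
    then have "(\<Sum>J\<in>P. ?c J * indicator (cube_interior J) x) = 0"
      by (intro sum.neutral) (auto simp: indicator_def)
    then show ?thesis by simp
  qed
  then have "(\<integral>\<^sup>+x. (\<Sum>J\<in>P. ?c J * indicator (cube_interior J) x) \<partial>lborel) \<le> (\<integral>\<^sup>+x\<in>A. G x \<partial>lborel)"
    by (intro nn_integral_mono)
  moreover have "(\<integral>\<^sup>+x. (\<Sum>J\<in>P. ?c J * indicator (cube_interior J) x) \<partial>lborel)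
      = (\<Sum>J\<in>P. ?c J * emeasure lborel (cube_interior J))"
    by (subst nn_integral_sum) (simp_all add: meas nn_integral_cmult_indicator)
  ultimately have "2 ^ CARD('n) * (\<Sum>J\<in>P. ?c J * emeasure lborel (cube_interior J))
      \<le> 2 ^ CARD('n) * (\<integral>\<^sup>+x\<in>A. G x \<partial>lborel)"
    by (intro mult_left_mono) auto
  moreover have "2 ^ CARD('n) * (\<Sum>J\<in>P. ?c J * emeasure lborel (cube_interior J)) = of_nat (card P)"
    unfolding sum_distrib_left using one by simp
  ultimately show ?thesis by simp
qed

text \<open>The integrand is dominated by a sum of constants on cubes of finite volume; overlaps
  only enlarge this sum.\<close>

lemma integral_finite_if_bounded_on_cubes:
  fixes G :: "real ^ 'n::finite \<Rightarrow> ennreal"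
  assumes "finite P" and cover: "A \<subseteq> (\<Union>J\<in>P. cube_set J)"
    and bounded: "\<And>J. J \<in> P \<Longrightarrow> \<exists>c<\<infinity>. \<forall>x\<in>cube_set J. G x \<le> c"
  shows "(\<integral>\<^sup>+x\<in>A. G x \<partial>lborel) < \<infinity>"
proof -
  obtain c where c: "\<And>J. J \<in> P \<Longrightarrow> c J < \<infinity>" "\<And>J x. J \<in> P \<Longrightarrow> x \<in> cube_set J \<Longrightarrow> G x \<le> c J"
    using bounded by metis
  have meas [measurable]: "cube_set J \<in> sets borel" and fin: "emeasure lborel (cube_set J) < \<infinity>"
    for J :: "'n cube"
    by (cases J; simp add: cube_set_cbox emeasure_lborel_cbox_eq)+
  have "G x * indicator A x \<le> (\<Sum>J\<in>P. c J * indicator (cube_set J) x)" for x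
  proof (cases "x \<in> A")
    case True
    then obtain J where J: "J \<in> P" "x \<in> cube_set J" using cover by blast
    have "G x * indicator A x \<le> c J * indicator (cube_set J) x" using J True c(2) by simp
    also have "\<dots> \<le> (\<Sum>J\<in>P. c J * indicator (cube_set J) x)"
      using assms(1) J(1) by (intro member_le_sum) auto
    finally show ?thesis .
  qed simp
  then have "(\<integral>\<^sup>+x\<in>A. G x \<partial>lborel) \<le> (\<integral>\<^sup>+x. (\<Sum>J\<in>P. c J * indicator (cube_set J) x) \<partial>lborel)"
    by (intro nn_integral_mono)
  also have "\<dots> = (\<Sum>J\<in>P. c J * emeasure lborel (cube_set J))"
    by (subst nn_integral_sum) (simp_all add: meas nn_integral_cmult_indicator)
  also have "\<dots> < \<infinity>"
    using c(1) fin assms(1) by (auto simp: ennreal_mult_less_top)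
  finally show ?thesis .
qed

text \<open>Turns the distance bound for a failing cube of width \<open>w\<close> into a lower bound
  for a fraction in the integrand.\<close>

lemma fraction_ge_if_distance_le:
  assumes "0 < a" "0 < b" "0 < w" "\<delta> \<le> ennreal (w * a / b)"
  shows "ennreal (1 / w) \<le> ennreal a / (ennreal b * \<delta>)"
proof (cases \<delta>)
  case (real t)
  have t: "t \<le> w * a / b" using assms real by (simp add: ennreal_le_iff)
  show ?thesis
  \<comment> \<open>At distance 0 the fraction is a positive number over 0, which is
    infinite.\<close>
  proof (cases "t = 0")
    case True
    then show ?thesis using assms real by simp
  next
    case False
    have "ennreal a / (ennreal b * \<delta>) = ennreal (a / (b * t))"
      using assms real False by (simp add: divide_ennreal flip: ennreal_mult')
    moreover have "1 / w \<le> a / (b * t)"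
      using assms real False t by (simp add: field_simps)
    ultimately show ?thesis by (simp add: ennreal_leI)
  qed
next
  case top
  then show ?thesis using assms by (simp add: top_unique)
qed

lemma fraction_le_if_distance_ge:
  assumes "0 \<le> a" "0 < b" "0 < e" "ennreal e \<le> \<delta>"
  shows "ennreal a / (ennreal b * \<delta>) \<le> ennreal (a / (b * e))"
proof (cases \<delta>)
  case (real t)
  have t: "e \<le> t" using assms real by simp
  then have "ennreal a / (ennreal b * \<delta>) = ennreal (a / (b * t))"
    using assms real by (simp add: divide_ennreal flip: ennreal_mult')
  also have "\<dots> \<le> ennreal (a / (b * e))"
    using assms t by (intro ennreal_leI divide_left_mono mult_left_mono) auto
  finally show ?thesis .
next
  \<comment> \<open>An infinite distance means an empty zero set; the fraction is then 0.\<close>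
  case top
  then show ?thesis using assms by (simp add: ennreal_mult_top)
qed

section \<open>The bound on the number of regions and the criterion for termination\<close>

lemma vjoin_in_cube_square:
  assumes "x \<in> cube_set Q"
  shows "vjoin x x \<in> cube_set (cube_square Q)"
  using assms by (auto simp: cube_set_def cube_square_def vjoin_def split: prod.splits sum.split)

text \<open>The run \<open>s\<close> is arbitrary, so every order of subdivision is covered. The
  cardinality estimate is proved for all partitions of the run, because it also forces
  termination.\<close>

theorem theorem25:
  fixes f :: "'n::finite rpoly" and I :: "'n cube" and n d :: real and integral_bound :: ennreal
    and s :: "nat \<Rightarrow> 'n cube set"
  assumes nonconst: "\<not> is_constant f"
    and width_pos: "snd I > 0"
    and n_def: "n = real CARD('n)"
    and d_def: "d = real (pdeg f)"
    and integral_def: "integral_bound =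
      (\<integral>\<^sup>+ x \<in> cube_set I.
         min ((ennreal (2 powr n * d + sqrt n * ln (1 + 2 powr (2 - 2 * n)))
               / (ennreal (2 * ln (1 + 2 powr (2 - 2 * n))) * dist_C x f)) ^ CARD('n))
             ((ennreal (2 powr (2 * n + 1) * (d - 1) + sqrt (2 * n) * ln (1 + 2 powr (2 - 4 * n)))
               / (ennreal (2 * ln (1 + 2 powr (2 - 4 * n))) * dist_C (vjoin x x) (grad_prod f)))
              ^ CARD('n))
       \<partial>lborel)"
    and run: "PV_run f I s"
  shows "(\<forall>k. terminal f (s k) \<longrightarrow>
            of_nat (card (s k)) \<le> max 1 (2 ^ CARD('n) * integral_bound)) \<and>
         (\<not> PV_terminates f s \<longleftrightarrow> integral_bound = \<infinity>)"
proof -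
  define L1 where "L1 = ln (1 + 2 powr (2 - 2 * n))"
  define L2 where "L2 = ln (1 + 2 powr (2 - 4 * n))"
  define a1 where "a1 = 2 powr n * d + sqrt n * L1"
  define a2 where "a2 = 2 powr (2 * n + 1) * (d - 1) + sqrt (2 * n) * L2"
  define G1 where "G1 x = (ennreal a1 / (ennreal (2 * L1) * dist_C x f)) ^ CARD('n)" for x
  define G2 where "G2 x = (ennreal a2 / (ennreal (2 * L2) * dist_C (vjoin x x) (grad_prod f))) ^ CARD('n)" for x
  have integral: "integral_bound = (\<integral>\<^sup>+x\<in>cube_set I. min (G1 x) (G2 x) \<partial>lborel)"
    unfolding integral_def G1_def G2_def a1_def a2_def L1_def L2_def ..
  have n: "0 < n" by (simp add: n_def)
  have d: "1 \<le> d" using pdeg_pos_if_nonconstant[OF nonconst] by (simp add: d_def)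
  have L: "0 < L1" "0 < L2" unfolding L1_def L2_def by (rule ln_gt_zero; simp)+
  have a: "0 < a1" "0 < a2"
    using n d L by (auto simp: a1_def a2_def intro!: add_nonneg_pos)

  have card_bound: "of_nat (card (s k)) \<le> max 1 (2 ^ CARD('n) * integral_bound)" for k
  proof -
    have inv: "PV_invariant f I (s k)" by (rule PV_run_invariant[OF run width_pos])
    show ?thesis
    proof (cases "s k = {I}")
      case True
      then show ?thesis by simp
    next
      case False
      have "of_nat (card (s k)) \<le> 2 ^ CARD('n) * integral_bound"
        unfolding integral
      proof (rule card_cubes_le_integral)
        fix J x assume J: "J \<in> s k" and x: "x \<in> cube_set J"
        \<comment> \<open>The lower bound at \<open>x\<close> comes from the parent: both of its
          tests fail, and its width is twice that of \<open>J\<close>.\<close>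
        obtain Q where Q: "snd Q = 2 * snd J" "cube_set J \<subseteq> cube_set Q" "\<not> C0 f Q" "\<not> C1 f Q"
          using inv False J unfolding PV_invariant_def by blast
        have "0 < snd J" using inv J by (simp add: PV_invariant_def)
        obtain m w where mw: "Q = (m, w)" by (cases Q)
        have w: "0 < w" "w = 2 * snd J" using Q(1) \<open>0 < snd J\<close> by (auto simp: mw)
        have xQ: "x \<in> cube_set (m, w)" using x Q(2) by (auto simp: mw)
        have "dist_C x f \<le> ennreal (w * a1 / (2 * L1))"
          using dist_C_le_if_zero_in_centered_form[of f m w x d] Q(3) w(1) xQ
          by (simp add: C0_def mw a1_def L1_def n_def d_def)
        then have "ennreal (1 / w) ^ CARD('n) \<le> G1 x"
          unfolding G1_def using a L w by (intro power_mono_ennreal fraction_ge_if_distance_le) auto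
        moreover have "dist_C (vjoin x x) (grad_prod f) \<le> ennreal (w * a2 / (2 * L2))"
        proof -
          \<comment> \<open>With 2n variables, 2 - 2N becomes 2 - 4n and sqrt N becomes sqrt(2n), as
            in the second fraction.\<close>
          have N: "real CARD('n + 'n) = 2 * n" by (simp add: n_def)
          have pow: "2 powr (2 * n) * (2 * (d - 1)) = 2 powr (2 * n + 1) * (d - 1)"
            by (simp add: powr_add)
          have "real (pdeg (grad_prod f)) \<le> real (2 * (pdeg f - 1))"
            using pdeg_grad_prod_le[of f] by (rule of_nat_mono)
          also have "\<dots> = 2 * (d - 1)"
            using d by (simp add: d_def of_nat_diff)
          finally have deg: "real (pdeg (grad_prod f)) \<le> 2 * (d - 1)" .
          have "vjoin x x \<in> cube_set (vjoin m m, w)"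
            using vjoin_in_cube_square[OF xQ] by (simp add: cube_square_def)
          moreover have "0 \<in> centered_form (grad_prod f) (vjoin m m, w)"
            using Q(4) by (simp add: C1_def mw cube_square_def)
          ultimately show ?thesis
            using dist_C_le_if_zero_in_centered_form[OF _ w(1) _ deg, of "vjoin m m" "vjoin x x"]
            unfolding N pow by (simp add: a2_def L2_def)
        qed
        then have "ennreal (1 / w) ^ CARD('n) \<le> G2 x"
          unfolding G2_def using a L w by (intro power_mono_ennreal fraction_ge_if_distance_le) auto
        ultimately show "ennreal (1 / (2 * snd J)) ^ CARD('n) \<le> min (G1 x) (G2 x)"
          by (simp add: w(2))
      qed (use inv in \<open>auto simp: PV_invariant_def\<close>)
      then show ?thesis by (simp add: le_max_iff_disj)
    qed
  qed

  have "PV_terminates f s" if "integral_bound \<noteq> \<infinity>"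
  proof (rule ccontr)
    assume nonterm: "\<not> PV_terminates f s"
    \<comment> \<open>A finite bound lies below some natural number \<open>c\<close>, but after
      \<open>c\<close> steps there are more than \<open>c\<close> cubes.\<close>
    have "max 1 (2 ^ CARD('n) * integral_bound) < top"
      using that by (simp add: ennreal_mult_less_top less_top power_less_top_ennreal)
    then obtain c :: nat where c: "max 1 (2 ^ CARD('n) * integral_bound) < of_nat c"
      using ennreal_Ex_less_of_nat by blast
    also have "(of_nat c :: ennreal) \<le> of_nat (card (s c))"
      using PV_run_card_gt[OF run width_pos nonterm, of c] by simp
    finally show False using card_bound[of c] by (rule leD[THEN notE, rotated])
  qed
  moreover have "integral_bound < \<infinity>" if terminates: "PV_terminates f s"
  proof -
    obtain k where term_k: "terminal f (s k)" using terminates by (auto simp: PV_terminates_def)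
    have inv: "PV_invariant f I (s k)" by (rule PV_run_invariant[OF run width_pos])
    show ?thesis unfolding integral
    proof (rule integral_finite_if_bounded_on_cubes)
      fix J assume J: "J \<in> s k"
      obtain m w where mw: "J = (m, w)" by (cases J)
      have w: "0 \<le> w" using inv J by (auto simp: PV_invariant_def mw)
      \<comment> \<open>One successful test suffices, since bounding one of the two terms bounds
        their minimum.\<close>
      consider "C0 f J" | "C1 f J" using term_k J by (auto simp: terminal_def)
      then show "\<exists>c<\<infinity>. \<forall>x\<in>cube_set J. min (G1 x) (G2 x) \<le> c"
      proof cases
        case 1
        then obtain \<delta> where \<delta>: "\<delta> > 0" "\<forall>x\<in>cube_set J. ennreal \<delta> \<le> dist_C x f"
          using dist_C_bounded_below_on_cube[of f m w] w by (auto simp: C0_def mw)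
        have "G1 x \<le> ennreal (a1 / (2 * L1 * \<delta>)) ^ CARD('n)" if "x \<in> cube_set J" for x
          unfolding G1_def using a L \<delta> that
          by (intro power_mono_ennreal fraction_le_if_distance_ge) auto
        then show ?thesis
          by (intro exI[of _ "ennreal (a1 / (2 * L1 * \<delta>)) ^ CARD('n)"])
             (auto simp: min_le_iff_disj power_less_top_ennreal)
      next
        case 2
        then obtain \<delta> where \<delta>: "\<delta> > 0"
          "\<forall>y\<in>cube_set (cube_square J). ennreal \<delta> \<le> dist_C y (grad_prod f)"
          using dist_C_bounded_below_on_cube[of "grad_prod f" "vjoin m m" w] w
          by (auto simp: C1_def mw cube_square_def)
        have "G2 x \<le> ennreal (a2 / (2 * L2 * \<delta>)) ^ CARD('n)" if "x \<in> cube_set J" for x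
          unfolding G2_def using a L \<delta> vjoin_in_cube_square[OF that]
          by (intro power_mono_ennreal fraction_le_if_distance_ge) auto
        then show ?thesis
          by (intro exI[of _ "ennreal (a2 / (2 * L2 * \<delta>)) ^ CARD('n)"])
             (auto simp: min_le_iff_disj power_less_top_ennreal)
      qed
    qed (use inv in \<open>auto simp: PV_invariant_def\<close>)
  qed
  ultimately show ?thesis using card_bound by auto
qed

end
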